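(* Let $n\ge1$, let $A$ be the pseudo-differential operator with symbol $\mathcal{A}\in\mathcal{E}(\mathbb{Q}_2^n\setminus\{0\})$, let $s=(s_1,\dots,s_n)$ with $s_\nu\in\mathbb{N}_0$, with admissible coefficients (as defined in the context) of level $s_\nu$ fixed for each $\nu$, and let $e\subset\{1,\dots,n\}$, $e\neq\emptyset$, $j\in\mathbb{Z}$, $a\in I_2^n$. Then the function $$\Psi^{(s)}_{e;ja}(x)=2^{-nj/2}\sum_{r_1=0}^{2^{s_1}-1}\cdots\sum_{r_n=0}^{2^{s_n}-1}\alpha^{(k_e)_1}_{1,r_1}\cdots\alpha^{(k_e)_n}_{n,r_n}\,\Psi^{(0)}_e\Big(2^jx-a-\Big(\frac{r_1}{2^{s_1}}(k_e)_1,\dots,\frac{r_n}{2^{s_n}}(k_e)_n\Big)\Big)$$ is an eigenfunction of $A$ if and only if $$\mathcal{A}\big(2^j(-2^{-1}k_e+\eta)\big)=\mathcal{A}\big(-2^{j-1}k_e\big)\qquad\text{for all }\eta\in\mathbb{Z}_2^n.$$ The corresponding eigenvalue is $\lambda=\mathcal{A}(-2^{j-1}k_e)$, i.e. $A\Psi^{(s)}_{e;ja}=\mathcal{A}(-2^{j-1}k_e)\Psi^{(s)}_{e;ja}$.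
   Context: $\mathbb{Q}_2$ is the field of $2$-adic numbers; on $\mathbb{Q}_2^n$ use the norm $|x|_2=\max_\nu|x_\nu|_2$ and the product Haar measure $d^nx$ normalized so that $\mathbb{Z}_2^n$ has measure $1$. $\chi_2(t)=e^{2\pi i\{t\}_2}$, $t\in\mathbb{Q}_2$, with $\{t\}_2$ the $2$-adic fractional part; $\xi\cdot x=\sum_\nu\xi_\nu x_\nu$. $\Omega(t)=1$ for $0\le t\le1$, $\Omega(t)=0$ for $t>1$. $I_2=\{2^{-\gamma}(a_0+a_12+\cdots+a_{\gamma-1}2^{\gamma-1}):\gamma\in\mathbb{N},\ a_j\in\{0,1\}\}\subset\mathbb{Q}_2$, $I_2^n=I_2\times\cdots\times I_2$, $\mathbb{N}_0=\{0,1,2,\dots\}$. For $e\subset\{1,\dots,n\}$, $k_e\in\{0,1\}^n$ has $(k_e)_\nu=1$ if $\nu\in e$ and $0$ otherwise, and $\Psi^{(0)}_e(x)=\chi_2(2^{-1}k_e\cdot x)\,\Omega(|x|_2)$. Admissible coefficients of level $s_\nu$: if $s_\nu\ge1$, choose $\gamma_{\nu,0},\dots,\gamma_{\nu,2^{s_\nu}-1}\in\mathbb{C}$ of modulus $1$ and put $$\alpha^1_{\nu,k}=2^{-s_\nu}(-1)^k\sum_{r=0}^{2^{s_\nu}-1}\gamma_{\nu,r}\,e^{-i\pi\frac{2r+1}{2^{s_\nu}}k},\quad k=0,\dots,2^{s_\nu}-1;$$ if $s_\nu=0$, put $\alpha^1_{\nu,0}=1$. In all cases put $\alpha^0_{\nu,0}=1$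 and $\alpha^0_{\nu,k}=0$ for $k=1,\dots,2^{s_\nu}-1$. (The superscripts $0,1$ are indices, not powers.) $\mathcal{D}(\mathbb{Q}_2^n)$ is the space of locally constant compactly supported functions $\mathbb{Q}_2^n\to\mathbb{C}$; $\mathcal{E}(\mathbb{Q}_2^n\setminus\{0\})$ is the space of locally constant functions $\mathbb{Q}_2^n\setminus\{0\}\to\mathbb{C}$. Fourier transform: $F[\varphi](\xi)=\int_{\mathbb{Q}_2^n}\chi_2(\xi\cdot x)\varphi(x)\,d^nx$, with inverse $F^{-1}[\varphi](x)=\int_{\mathbb{Q}_2^n}\chi_2(-x\cdot\xi)\varphi(\xi)\,d^n\xi$. The Lizorkin space is $\Phi(\mathbb{Q}_2^n)=\{\phi\in\mathcal{D}(\mathbb{Q}_2^n):\int\phi\,d^nx=0\}$, equivalently those $\phi\in\mathcal{D}(\mathbb{Q}_2^n)$ with $F[\phi](0)=0$; each $\Psi^{(s)}_{e;ja}$ belongs to it. The pseudo-differential operator $A$ with symbol $\mathcal{A}$ is $A\phi=F^{-1}\big[\mathcal{A}\,F[\phi]\big]$ for $\phi\in\Phi(\mathbb{Q}_2^n)$ (here $F[\phi]$ vanishes near $0$, and $\mathcal{A}F[\phi]$ is taken to be $0$ at $0$). An eigenfunction is a nonzero $f$ with $Af=\lambda f$ for some $\lambda\in\mathbb{C}$. *)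

theory Defs
  imports "HOL-Analysis.Analysis"
begin

section \<open>The field of 2-adic numbers\<close>

subsection \<open>The 2-adic absolute value on the rationals\<close>

definition abs2 :: "rat \<Rightarrow> real" where
  "abs2 x = (if x = 0 then 0 else
     2 powi (int (multiplicity 2 (snd (quotient_of x))) - int (multiplicity 2 (fst (quotient_of x)))))"

lemma abs2_0 [simp]: "abs2 0 = 0"
  by (simp add: abs2_def)

lemma abs2_divide:
  fixes a b :: int
  assumes "a \<noteq> 0" "b \<noteq> 0"
  shows "abs2 (of_int a / of_int b) = 2 powi (int (multiplicity 2 b) - int (multiplicity 2 a))"
proof -
  obtain p q where pq: "quotient_of (of_int a / of_int b) = (p, q)" by fastforce
  then have q: "q > 0" and eq: "of_int a / of_int b = (of_int p / of_int q :: rat)"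
    using quotient_of_denom_pos quotient_of_div by blast+
  have "(of_int (a * q) :: rat) = of_int (p * b)"
    using eq q assms by (simp add: field_simps)
  then have aq: "a * q = p * b" by linarith
  then have p: "p \<noteq> 0" using assms q by auto
  have "multiplicity 2 (a * q) = multiplicity 2 a + multiplicity 2 q"
       "multiplicity 2 (p * b) = multiplicity 2 p + multiplicity 2 b"
    using assms p q by (auto intro!: prime_elem_multiplicity_mult_distrib)
  then have "int (multiplicity 2 a) + int (multiplicity 2 q) = int (multiplicity 2 p) + int (multiplicity 2 b)"
    using aq by (metis of_nat_add)
  then have "int (multiplicity 2 q) - int (multiplicity 2 p) = int (multiplicity 2 b) - int (multiplicity 2 a)"
    by linarith
  then show ?thesis
    using assms by (simp add: abs2_def pq)
qed

lemma abs2_pos: "x \<noteq> 0 \<Longrightarrow> abs2 x > 0"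
  by (simp add: abs2_def)

lemma abs2_nonneg [simp]: "abs2 x \<ge> 0"
  using abs2_pos[of x] by (cases "x = 0") auto

lemma abs2_eq_0_iff [simp]: "abs2 x = 0 \<longleftrightarrow> x = 0"
  using abs2_pos[of x] by (cases "x = 0") auto

lemma rat_as_fraction:
  fixes x :: rat
  obtains a b :: int where "b \<noteq> 0" "x = of_int a / of_int b"
  by (metis quotient_of_denom_pos quotient_of_div surj_pair less_irrefl)

lemma abs2_mult [simp]: "abs2 (x * y) = abs2 x * abs2 y"
proof (cases "x = 0 \<or> y = 0")
  case False
  obtain a b where ab: "b \<noteq> 0" "x = of_int a / of_int b" by (rule rat_as_fraction)
  obtain c d where cd: "d \<noteq> 0" "y = of_int c / of_int d" by (rule rat_as_fraction)
  have nz: "a \<noteq> 0" "c \<noteq> 0" using False ab cd by auto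
  have xy: "x * y = of_int (a * c) / of_int (b * d)" using ab cd by simp
  have m: "multiplicity 2 (a * c) = multiplicity 2 a + multiplicity 2 c"
       "multiplicity 2 (b * d) = multiplicity 2 b + multiplicity 2 d"
    using nz ab cd by (auto intro!: prime_elem_multiplicity_mult_distrib)
  have "abs2 (x * y) = 2 powi (int (multiplicity 2 (b * d)) - int (multiplicity 2 (a * c)))"
    unfolding xy using nz ab cd by (intro abs2_divide) auto
  also have "\<dots> = 2 powi (int (multiplicity 2 b) - int (multiplicity 2 a))
      * 2 powi (int (multiplicity 2 d) - int (multiplicity 2 c))"
    by (simp add: m power_int_add[symmetric] algebra_simps)
  also have "\<dots> = abs2 x * abs2 y"
    using nz ab cd by (simp add: abs2_divide)
  finally show ?thesis .
qed auto

lemma abs2_minus [simp]: "abs2 (- x) = abs2 x"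
proof -
  have "abs2 (-1) = 1" using abs2_divide[of "-1" 1] by (simp add: multiplicity_unit_right)
  then show ?thesis using abs2_mult[of "-1" x] by simp
qed

lemma abs2_1 [simp]: "abs2 1 = 1"
  using abs2_divide[of 1 1] by simp

lemma abs2_inverse [simp]: "abs2 (inverse x) = inverse (abs2 x)"
proof (cases "x = 0")
  case False
  then have "abs2 x * abs2 (inverse x) = 1" by (simp flip: abs2_mult)
  then show ?thesis by (metis inverse_unique)
qed auto

lemma abs2_minus_commute: "abs2 (x - y) = abs2 (y - x)"
  using abs2_minus[of "x - y"] by simp

lemma abs2_ultrametric: "abs2 (x + y) \<le> max (abs2 x) (abs2 y)"
proof (cases "x = 0 \<or> y = 0 \<or> x + y = 0")
  case True
  then show ?thesis by (auto simp: max_def)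
next
  case False
  obtain a b where ab: "b \<noteq> 0" "x = of_int a / of_int b" by (rule rat_as_fraction)
  obtain c d where cd: "d \<noteq> 0" "y = of_int c / of_int d" by (rule rat_as_fraction)
  define u v w where "u = a * d" and "v = c * b" and "w = b * d"
  have w: "w \<noteq> 0" and x: "x = of_int u / of_int w" and y: "y = of_int v / of_int w"
    using ab cd by (auto simp: u_def v_def w_def)
  then have xy: "x + y = of_int (u + v) / of_int w" by (simp add: add_divide_distrib)
  have nz: "u \<noteq> 0" "v \<noteq> 0" "u + v \<noteq> 0" using False x y xy by auto
  let ?m = "min (multiplicity 2 u) (multiplicity 2 v)"
  have "2 ^ ?m dvd u + v" by (intro dvd_add multiplicity_dvd') auto
  then have m: "?m \<le> multiplicity 2 (u + v)"
    using nz by (intro multiplicity_geI) auto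
  have *: "abs2 (x + y) = 2 powi (int (multiplicity 2 w) - int (multiplicity 2 (u + v)))"
    unfolding xy using nz w by (intro abs2_divide) auto
  have **: "abs2 x = 2 powi (int (multiplicity 2 w) - int (multiplicity 2 u))"
    unfolding x using nz w by (intro abs2_divide) auto
  have "abs2 y = 2 powi (int (multiplicity 2 w) - int (multiplicity 2 v))"
    unfolding y using nz w by (intro abs2_divide) auto
  note * = * ** this
  show ?thesis
  proof (cases "multiplicity 2 u \<le> multiplicity 2 v")
    case True
    then have "abs2 (x + y) \<le> abs2 x"
      unfolding * using m by (intro power_int_increasing) auto
    then show ?thesis by simp
  next
    case False
    then have "abs2 (x + y) \<le> abs2 y"
      unfolding * using m by (intro power_int_increasing) auto
    then show ?thesis by simp
  qed
qed

lemma abs2_triangle: "abs2 (x + y) \<le> abs2 x + abs2 y"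
  using abs2_ultrametric[of x y] abs2_nonneg[of x] abs2_nonneg[of y] by linarith

lemma abs2_triangle_diff: "\<bar>abs2 x - abs2 y\<bar> \<le> abs2 (x - y)"
  using abs2_triangle[of "x - y" y] abs2_triangle[of "y - x" x] abs2_minus_commute[of x y]
  by auto


subsection \<open>Completion: Cauchy sequences modulo null sequences\<close>

definition Cauchy2 :: "(nat \<Rightarrow> rat) \<Rightarrow> bool" where
  "Cauchy2 X \<longleftrightarrow> (\<forall>e>0. \<exists>N. \<forall>m\<ge>N. \<forall>n\<ge>N. abs2 (X m - X n) < e)"

definition null2 :: "(nat \<Rightarrow> rat) \<Rightarrow> bool" where
  "null2 X \<longleftrightarrow> (\<lambda>n. abs2 (X n)) \<longlonglongrightarrow> 0"

lemma null2_const [simp]: "null2 (\<lambda>n. c) \<longleftrightarrow> c = 0"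
  by (simp add: null2_def LIMSEQ_const_iff)

lemma null2_le:
  assumes "null2 X" "\<And>n. abs2 (Y n) \<le> C * abs2 (X n)"
  shows "null2 Y"
  unfolding null2_def
  using tendsto_mult_right_zero[OF assms(1)[unfolded null2_def], of C]
  by (rule Lim_null_comparison[rotated]) (auto simp: assms(2))

lemma null2_add: "null2 X \<Longrightarrow> null2 Y \<Longrightarrow> null2 (\<lambda>n. X n + Y n)"
  unfolding null2_def
  by (rule tendsto_sandwich[where f = "\<lambda>_. 0" and h = "\<lambda>n. abs2 (X n) + abs2 (Y n)"])
     (auto intro!: always_eventually abs2_triangle tendsto_add_zero)

lemma null2_minus: "null2 X \<Longrightarrow> null2 (\<lambda>n. - X n)"
  by (simp add: null2_def)

lemma Cauchy2_const [simp]: "Cauchy2 (\<lambda>n. c)"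
  by (simp add: Cauchy2_def)

lemma Cauchy2_minus: "Cauchy2 X \<Longrightarrow> Cauchy2 (\<lambda>n. - X n)"
  by (simp add: Cauchy2_def abs2_minus_commute)

lemma Cauchy2_add:
  assumes "Cauchy2 X" "Cauchy2 Y"
  shows "Cauchy2 (\<lambda>n. X n + Y n)"
  unfolding Cauchy2_def
proof (intro allI impI)
  fix e :: real assume "e > 0"
  then obtain M N where MN: "\<forall>m\<ge>M. \<forall>n\<ge>M. abs2 (X m - X n) < e" "\<forall>m\<ge>N. \<forall>n\<ge>N. abs2 (Y m - Y n) < e"
    using assms unfolding Cauchy2_def by meson
  have "abs2 (X m + Y m - (X n + Y n)) < e" if "m \<ge> max M N" "n \<ge> max M N" for m n
  proof -
    have "abs2 (X m + Y m - (X n + Y n)) \<le> max (abs2 (X m - X n)) (abs2 (Y m - Y n))"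
      using abs2_ultrametric[of "X m - X n" "Y m - Y n"] by (simp add: algebra_simps)
    also have "\<dots> < e" using MN that by simp
    finally show ?thesis .
  qed
  then show "\<exists>N. \<forall>m\<ge>N. \<forall>n\<ge>N. abs2 (X m + Y m - (X n + Y n)) < e" by blast
qed

lemma Cauchy2_convergent_abs2:
  assumes "Cauchy2 X"
  shows "convergent (\<lambda>n. abs2 (X n))"
proof -
  have "Cauchy (\<lambda>n. abs2 (X n))"
    unfolding Cauchy_def dist_real_def
    using assms abs2_triangle_diff unfolding Cauchy2_def by (meson order.strict_trans1)
  then show ?thesis by (simp add: Cauchy_convergent_iff)
qed

lemma Cauchy2_tendsto: "Cauchy2 X \<Longrightarrow> (\<lambda>n. abs2 (X n)) \<longlonglongrightarrow> lim (\<lambda>n. abs2 (X n))"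
  using Cauchy2_convergent_abs2 convergent_LIMSEQ_iff by blast

lemma Cauchy2_bounded:
  assumes "Cauchy2 X"
  obtains C where "C > 0" "\<And>n. abs2 (X n) \<le> C"
proof -
  have "Bseq (\<lambda>n. abs2 (X n))"
    using Cauchy2_convergent_abs2[OF assms] by (rule convergent_imp_Bseq)
  then show ?thesis using that unfolding Bseq_def by auto
qed

lemma null2_mult_bounded:
  assumes "Cauchy2 X" "null2 Y"
  shows "null2 (\<lambda>n. X n * Y n)"
proof -
  obtain C where C: "\<And>n. abs2 (X n) \<le> C" using Cauchy2_bounded[OF assms(1)] by blast
  show ?thesis
    by (rule null2_le[OF assms(2), of _ C]) (simp add: C mult_right_mono)
qed

lemma Cauchy2_mult:
  assumes "Cauchy2 X" "Cauchy2 Y"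
  shows "Cauchy2 (\<lambda>n. X n * Y n)"
  unfolding Cauchy2_def
proof (intro allI impI)
  fix e :: real assume e: "e > 0"
  obtain C where C: "C > 0" "\<And>n. abs2 (X n) \<le> C" using Cauchy2_bounded[OF assms(1)] by blast
  obtain D where D: "D > 0" "\<And>n. abs2 (Y n) \<le> D" using Cauchy2_bounded[OF assms(2)] by blast
  obtain M where M: "\<forall>m\<ge>M. \<forall>n\<ge>M. abs2 (X m - X n) < e / D"
    using assms(1) e D unfolding Cauchy2_def by (meson divide_pos_pos)
  obtain N where N: "\<forall>m\<ge>N. \<forall>n\<ge>N. abs2 (Y m - Y n) < e / C"
    using assms(2) e C unfolding Cauchy2_def by (meson divide_pos_pos)
  have "abs2 (X m * Y m - X n * Y n) < e" if "m \<ge> max M N" "n \<ge> max M N" for m n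
  proof -
    have "X m * Y m - X n * Y n = X m * (Y m - Y n) + (X m - X n) * Y n"
      by (simp add: algebra_simps)
    then have "abs2 (X m * Y m - X n * Y n)
        \<le> max (abs2 (X m) * abs2 (Y m - Y n)) (abs2 (X m - X n) * abs2 (Y n))"
      using abs2_ultrametric[of "X m * (Y m - Y n)" "(X m - X n) * Y n"] by simp
    also have "\<dots> \<le> max (C * abs2 (Y m - Y n)) (abs2 (X m - X n) * D)"
      by (intro max.mono mult_right_mono mult_left_mono C D) auto
    also have "\<dots> < e" using M N that C D by (auto simp: field_simps)
    finally show ?thesis .
  qed
  then show "\<exists>N. \<forall>m\<ge>N. \<forall>n\<ge>N. abs2 (X m * Y m - X n * Y n) < e" by blast
qed

lemma Cauchy2_not_null2:
  assumes "Cauchy2 X" "\<not> null2 X"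
  obtains b N where "b > 0" "\<And>n. n \<ge> N \<Longrightarrow> abs2 (X n) > b"
proof -
  let ?l = "lim (\<lambda>n. abs2 (X n))"
  have lim: "(\<lambda>n. abs2 (X n)) \<longlonglongrightarrow> ?l" using assms(1) by (rule Cauchy2_tendsto)
  have "?l \<ge> 0" by (rule LIMSEQ_le_const[OF lim]) auto
  moreover have "?l \<noteq> 0" using lim assms(2) unfolding null2_def by metis
  ultimately have l: "?l > 0" by simp
  then have "\<forall>\<^sub>F n in sequentially. abs2 (X n) > ?l / 2"
    by (intro order_tendstoD(1)[OF lim]) auto
  then show ?thesis using l that[of "?l / 2"] unfolding eventually_sequentially by auto
qed

lemma abs2_inverse_diff:
  assumes "x \<noteq> 0" "y \<noteq> 0"
  shows "abs2 (inverse x - inverse y) = abs2 (x - y) / (abs2 x * abs2 y)"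
proof -
  have "inverse x - inverse y = (y - x) * inverse (x * y)"
    using assms by (simp add: field_simps)
  then have "abs2 (inverse x - inverse y) = abs2 ((y - x) * inverse (x * y))" by (rule arg_cong)
  then show ?thesis by (simp add: abs2_minus_commute[of y x] divide_inverse)
qed

lemma Cauchy2_inverse:
  assumes X: "Cauchy2 X" "\<not> null2 X"
  shows "Cauchy2 (\<lambda>n. inverse (X n))"
  unfolding Cauchy2_def
proof (intro allI impI)
  fix e :: real assume e: "e > 0"
  obtain b N where b: "b > 0" "\<And>n. n \<ge> N \<Longrightarrow> abs2 (X n) > b" using Cauchy2_not_null2[OF X] by blast
  have "e * (b * b) > 0" using e b by simp
  then obtain M where M: "\<forall>m\<ge>M. \<forall>n\<ge>M. abs2 (X m - X n) < e * (b * b)"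
    using X(1) unfolding Cauchy2_def by meson
  have "abs2 (inverse (X m) - inverse (X n)) < e" if "m \<ge> max M N" "n \<ge> max M N" for m n
  proof -
    have bb: "abs2 (X m) > b" "abs2 (X n) > b" using b that by auto
    then have nz: "X m \<noteq> 0" "X n \<noteq> 0" using b by auto
    have "b * b \<le> abs2 (X m) * abs2 (X n)" using bb b by (intro mult_mono) auto
    then have "abs2 (X m - X n) / (abs2 (X m) * abs2 (X n)) \<le> abs2 (X m - X n) / (b * b)"
      using b by (intro divide_left_mono) (auto intro!: mult_pos_pos abs2_pos nz)
    also have "\<dots> < e" using M that b by (simp add: pos_divide_less_eq)
    finally show ?thesis by (simp add: abs2_inverse_diff nz)
  qed
  then show "\<exists>N. \<forall>m\<ge>N. \<forall>n\<ge>N. abs2 (inverse (X m) - inverse (X n)) < e" by blast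
qed

lemma null2_inverse_diff:
  assumes X: "Cauchy2 X" "\<not> null2 X" and Y: "Cauchy2 Y" "\<not> null2 Y"
    and XY: "null2 (\<lambda>n. X n - Y n)"
  shows "null2 (\<lambda>n. inverse (X n) - inverse (Y n))"
proof -
  obtain a M where a: "a > 0" "\<And>n. n \<ge> M \<Longrightarrow> abs2 (X n) > a" using Cauchy2_not_null2[OF X] by blast
  obtain b N where b: "b > 0" "\<And>n. n \<ge> N \<Longrightarrow> abs2 (Y n) > b" using Cauchy2_not_null2[OF Y] by blast
  have "abs2 (inverse (X n) - inverse (Y n)) \<le> abs2 (X n - Y n) / (a * b)" if "n \<ge> max M N" for n
  proof -
    have bb: "abs2 (X n) > a" "abs2 (Y n) > b" using a b that by auto
    then have nz: "X n \<noteq> 0" "Y n \<noteq> 0" using a b by auto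
    have "a * b \<le> abs2 (X n) * abs2 (Y n)" using bb a b by (intro mult_mono) auto
    then show ?thesis unfolding abs2_inverse_diff[OF nz] using a b
      by (intro divide_left_mono) (auto intro!: mult_pos_pos abs2_pos nz)
  qed
  then have ev: "\<forall>\<^sub>F n in sequentially.
      norm (abs2 (inverse (X n) - inverse (Y n))) \<le> abs2 (X n - Y n) / (a * b)"
    unfolding eventually_sequentially real_norm_def abs_of_nonneg[OF abs2_nonneg] by blast
  have "(\<lambda>n. abs2 (X n - Y n) / (a * b)) \<longlonglongrightarrow> 0"
    using XY unfolding null2_def by (rule tendsto_divide_zero)
  then show ?thesis unfolding null2_def
    by (rule Lim_null_comparison[OF ev])
qed

definition Q2_rel :: "(nat \<Rightarrow> rat) \<Rightarrow> (nat \<Rightarrow> rat) \<Rightarrow> bool" where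
  "Q2_rel X Y \<longleftrightarrow> Cauchy2 X \<and> Cauchy2 Y \<and> null2 (\<lambda>n. X n - Y n)"

lemma part_equivp_Q2_rel: "part_equivp Q2_rel"
proof (rule part_equivpI)
  show "\<exists>X. Q2_rel X X" by (rule exI[of _ "\<lambda>_. 0"]) (simp add: Q2_rel_def)
  show "symp Q2_rel"
    by (rule sympI) (auto simp: Q2_rel_def null2_def abs2_minus_commute)
  show "transp Q2_rel"
  proof (rule transpI)
    fix X Y Z assume "Q2_rel X Y" "Q2_rel Y Z"
    then show "Q2_rel X Z"
      using null2_add[of "\<lambda>n. X n - Y n" "\<lambda>n. Y n - Z n"] by (auto simp: Q2_rel_def)
  qed
qed

text \<open>\<open>Q2\<close> is the completion of the rationals with respect to \<^const>\<open>abs2\<close>.\<close>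

quotient_type Q2 = "nat \<Rightarrow> rat" / partial: Q2_rel
  by (rule part_equivp_Q2_rel)

lemma null2_cong:
  assumes "null2 (\<lambda>n. X n - Y n)"
  shows "null2 X \<longleftrightarrow> null2 Y"
  using null2_add[OF assms, of Y] null2_add[OF null2_minus[OF assms], of X] by auto

instantiation Q2 :: field
begin

lift_definition zero_Q2 :: Q2 is "\<lambda>n. 0"
  by (simp add: Q2_rel_def)

lift_definition one_Q2 :: Q2 is "\<lambda>n. 1"
  by (simp add: Q2_rel_def)

lift_definition plus_Q2 :: "Q2 \<Rightarrow> Q2 \<Rightarrow> Q2" is "\<lambda>X Y n. X n + Y n"
proof -
  fix X X' Y Y' assume "Q2_rel X X'" "Q2_rel Y Y'"
  then show "Q2_rel (\<lambda>n. X n + Y n) (\<lambda>n. X' n + Y' n)"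
    using null2_add[of "\<lambda>n. X n - X' n" "\<lambda>n. Y n - Y' n"]
    by (auto simp: Q2_rel_def algebra_simps intro: Cauchy2_add)
qed

lift_definition uminus_Q2 :: "Q2 \<Rightarrow> Q2" is "\<lambda>X n. - X n"
proof -
  fix X X' assume "Q2_rel X X'"
  then show "Q2_rel (\<lambda>n. - X n) (\<lambda>n. - X' n)"
    using null2_minus[of "\<lambda>n. X n - X' n"]
    by (auto simp: Q2_rel_def intro: Cauchy2_minus)
qed

lift_definition times_Q2 :: "Q2 \<Rightarrow> Q2 \<Rightarrow> Q2" is "\<lambda>X Y n. X n * Y n"
proof -
  fix X X' Y Y' assume *: "Q2_rel X X'" "Q2_rel Y Y'"
  then have "null2 (\<lambda>n. X n * (Y n - Y' n) + Y' n * (X n - X' n))"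
    by (intro null2_add null2_mult_bounded) (auto simp: Q2_rel_def)
  then show "Q2_rel (\<lambda>n. X n * Y n) (\<lambda>n. X' n * Y' n)"
    using * by (auto simp: Q2_rel_def algebra_simps intro: Cauchy2_mult)
qed

lift_definition inverse_Q2 :: "Q2 \<Rightarrow> Q2" is
  "\<lambda>X. if null2 X then (\<lambda>n. 0) else (\<lambda>n. inverse (X n))"
proof -
  fix X Y assume "Q2_rel X Y"
  then show "Q2_rel (if null2 X then (\<lambda>n. 0) else (\<lambda>n. inverse (X n)))
                    (if null2 Y then (\<lambda>n. 0) else (\<lambda>n. inverse (Y n)))"
    using null2_cong[of X Y]
    by (auto simp: Q2_rel_def intro: Cauchy2_inverse null2_inverse_diff)
qed

definition minus_Q2 :: "Q2 \<Rightarrow> Q2 \<Rightarrow> Q2" where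
  "x - y = x + - (y::Q2)"

definition divide_Q2 :: "Q2 \<Rightarrow> Q2 \<Rightarrow> Q2" where
  "x div y = x * inverse (y::Q2)"

instance
proof
  fix a b c :: Q2
  show "a + b = b + a"
    by transfer (auto simp: Q2_rel_def add.commute intro: Cauchy2_add)
  show "(a + b) + c = a + (b + c)"
    by transfer (auto simp: Q2_rel_def add.assoc intro!: Cauchy2_add)
  show "0 + a = a"
    by transfer (auto simp: Q2_rel_def)
  show "- a + a = 0"
    by transfer (auto simp: Q2_rel_def)
  show "a - b = a + - b"
    by (rule minus_Q2_def)
  show "(a * b) * c = a * (b * c)"
    by transfer (auto simp: Q2_rel_def mult.assoc intro!: Cauchy2_mult)
  show "a * b = b * a"
    by transfer (auto simp: Q2_rel_def mult.commute intro: Cauchy2_mult)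
  show "1 * a = a"
    by transfer (auto simp: Q2_rel_def)
  show "(a + b) * c = a * c + b * c"
    by transfer (auto simp: Q2_rel_def distrib_right intro!: Cauchy2_mult Cauchy2_add)
  show "(0::Q2) \<noteq> 1"
    by transfer (simp add: Q2_rel_def)
  show "inverse a * a = 1" if "a \<noteq> 0"
    using that
  proof transfer
    fix X assume "Q2_rel X X" "\<not> Q2_rel X (\<lambda>n. 0)"
    then have X: "Cauchy2 X" "\<not> null2 X" by (auto simp: Q2_rel_def)
    obtain b N where b: "b > 0" "\<And>n. n \<ge> N \<Longrightarrow> abs2 (X n) > b" using Cauchy2_not_null2[OF X] by blast
    have "inverse (X n) * X n - 1 = 0" if "n \<ge> N" for n
      using b(1) b(2)[OF that] by (cases "X n = 0") auto
    then have "\<forall>\<^sub>F n in sequentially. abs2 (inverse (X n) * X n - 1) = 0"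
      unfolding eventually_sequentially by auto
    then have "null2 (\<lambda>n. inverse (X n) * X n - 1)"
      unfolding null2_def by (rule tendsto_eventually)
    then show "Q2_rel (\<lambda>n. (if null2 X then \<lambda>n. 0 else (\<lambda>n. inverse (X n))) n * X n) (\<lambda>n. 1)"
      using X by (auto simp: Q2_rel_def intro!: Cauchy2_mult Cauchy2_inverse)
  qed
  show "a div b = a * inverse b"
    by (rule divide_Q2_def)
  show "inverse (0::Q2) = 0"
    by transfer (simp add: Q2_rel_def)
qed

end


subsection \<open>The 2-adic norm and the induced topology\<close>

lift_definition norm2 :: "Q2 \<Rightarrow> real" is "\<lambda>X. lim (\<lambda>n. abs2 (X n))"
proof -
  fix X Y assume *: "Q2_rel X Y"
  then have "(\<lambda>n. abs2 (X n - Y n)) \<longlonglongrightarrow> 0" by (simp add: Q2_rel_def null2_def)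
  then have "(\<lambda>n. abs2 (X n) - abs2 (Y n)) \<longlonglongrightarrow> 0"
    by (rule Lim_null_comparison[rotated]) (simp add: abs2_triangle_diff)
  moreover have "(\<lambda>n. abs2 (X n) - abs2 (Y n)) \<longlonglongrightarrow> lim (\<lambda>n. abs2 (X n)) - lim (\<lambda>n. abs2 (Y n))"
    using * by (intro tendsto_diff Cauchy2_tendsto) (auto simp: Q2_rel_def)
  ultimately show "lim (\<lambda>n. abs2 (X n)) = lim (\<lambda>n. abs2 (Y n))"
    using LIMSEQ_unique by fastforce
qed

lemma norm2_eq_0: "norm2 x = 0 \<longleftrightarrow> x = (0::Q2)"
proof transfer
  fix X assume "Q2_rel X X"
  then have X: "Cauchy2 X" by (simp add: Q2_rel_def)
  show "lim (\<lambda>n. abs2 (X n)) = 0 \<longleftrightarrow> Q2_rel X (\<lambda>n. 0)"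
    using Cauchy2_tendsto[OF X] X unfolding Q2_rel_def null2_def by (simp, metis limI)
qed

lemma norm2_minus: "norm2 (- x) = norm2 (x::Q2)"
  by transfer simp

lemma norm2_ultrametric: "norm2 (x + y) \<le> max (norm2 x) (norm2 y)"
proof transfer
  fix X Y assume "Q2_rel X X" "Q2_rel Y Y"
  then have X: "Cauchy2 X" and Y: "Cauchy2 Y" by (auto simp: Q2_rel_def)
  show "lim (\<lambda>n. abs2 (X n + Y n)) \<le> max (lim (\<lambda>n. abs2 (X n))) (lim (\<lambda>n. abs2 (Y n)))"
    by (rule LIMSEQ_le[OF Cauchy2_tendsto[OF Cauchy2_add[OF X Y]]
          tendsto_max[OF Cauchy2_tendsto[OF X] Cauchy2_tendsto[OF Y]]])
       (auto simp: abs2_ultrametric)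
qed

lemma norm2_nonneg: "norm2 x \<ge> 0"
proof -
  have "norm2 (0::Q2) \<le> norm2 x"
    using norm2_ultrametric[of x "- x"] by (simp add: norm2_minus)
  then show ?thesis using norm2_eq_0[of 0] by simp
qed

instantiation Q2 :: metric_space
begin

text \<open>The library constant \<^const>\<open>norm\<close> is restricted to real normed vector spaces, so the
  absolute value \<^term>\<open>norm2\<close> is a separate constant; it induces the metric.\<close>

definition dist_Q2 :: "Q2 \<Rightarrow> Q2 \<Rightarrow> real" where
  "dist_Q2 x y = norm2 (x - y)"

definition uniformity_Q2 :: "(Q2 \<times> Q2) filter" where
  "uniformity_Q2 = (INF e\<in>{0<..}. principal {(x, y). dist x y < e})"

definition open_Q2 :: "Q2 set \<Rightarrow> bool" where
  "open_Q2 U \<longleftrightarrow> (\<forall>x\<in>U. eventually (\<lambda>(x', y). x' = x \<longrightarrow> y \<in> U) uniformity)"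

instance
proof
  fix x y z :: Q2
  show "dist x y = 0 \<longleftrightarrow> x = y" by (simp add: dist_Q2_def norm2_eq_0)
  show "dist x y \<le> dist x z + dist y z"
    using norm2_ultrametric[of "x - z" "z - y"] norm2_minus[of "y - z"]
      norm2_nonneg[of "x - z"] norm2_nonneg[of "y - z"]
    by (simp add: dist_Q2_def)
qed (auto simp: uniformity_Q2_def open_Q2_def)

end

lemma norm2_mult: "norm2 (x * y) = norm2 x * norm2 y"
proof transfer
  fix X Y assume "Q2_rel X X" "Q2_rel Y Y"
  then have "(\<lambda>n. abs2 (X n) * abs2 (Y n)) \<longlonglongrightarrow> lim (\<lambda>n. abs2 (X n)) * lim (\<lambda>n. abs2 (Y n))"
    by (intro tendsto_mult Cauchy2_tendsto) (auto simp: Q2_rel_def)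
  then show "lim (\<lambda>n. abs2 (X n * Y n)) = lim (\<lambda>n. abs2 (X n)) * lim (\<lambda>n. abs2 (Y n))"
    unfolding abs2_mult by (rule limI)
qed

lemma of_nat_Q2_transfer: "rel_fun (=) pcr_Q2 (\<lambda>m _. of_nat m) of_nat"
proof (rule rel_funI, clarify)
  fix m show "pcr_Q2 (\<lambda>_. of_nat m) (of_nat m)"
  proof (induction m)
    case 0
    then show ?case using zero_Q2.transfer by simp
  next
    case (Suc m)
    have "pcr_Q2 (\<lambda>n. (\<lambda>_. 1) n + (\<lambda>_. of_nat m) n) (1 + of_nat m)"
      using plus_Q2.transfer one_Q2.transfer Suc.IH unfolding rel_fun_def by blast
    then show ?case by simp
  qed
qed

lemma of_nat_Q2_neq_0: "of_nat (Suc k) \<noteq> (0::Q2)"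
  supply [transfer_rule] = of_nat_Q2_transfer
  by transfer (simp add: Q2_rel_def del: of_nat_Suc)

instance Q2 :: field_char_0
proof (standard, rule injI)
  show "m = n" if "of_nat m = (of_nat n :: Q2)" for m n
  proof (rule ccontr)
    assume "m \<noteq> n"
    have *: False if "of_nat a = (of_nat b :: Q2)" "a < b" for a b :: nat
    proof -
      have "of_nat (Suc (b - a - 1)) = (0::Q2)" using that by (simp add: of_nat_diff)
      then show False using of_nat_Q2_neq_0 by blast
    qed
    show False using *[of m n] *[of n m] \<open>m \<noteq> n\<close> that by (metis linorder_neqE_nat)
  qed
qed


text \<open>Sanity check: \<^const>\<open>norm2\<close> extends the 2-adic absolute value of the rationals.\<close>

lemma norm2_of_nat: "norm2 (of_nat m) = abs2 (of_nat m)"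
  supply [transfer_rule] = of_nat_Q2_transfer
  by transfer simp

lemma norm2_of_int: "norm2 (of_int m) = abs2 (of_int m)"
proof (cases "m \<ge> 0")
  case True
  then show ?thesis using norm2_of_nat[of "nat m"] by simp
next
  case False
  then show ?thesis using norm2_of_nat[of "nat (- m)"] by (simp add: norm2_minus)
qed

lemma norm2_of_rat: "norm2 (of_rat r) = abs2 r"
proof -
  obtain a b where ab: "b \<noteq> 0" "r = of_int a / of_int b" by (rule rat_as_fraction)
  have "norm2 (of_rat r) * norm2 (of_int b) = norm2 (of_int a)"
    unfolding norm2_mult[symmetric] ab(2) using ab(1) by (simp add: of_rat_divide)
  moreover have "abs2 r * abs2 (of_int b) = abs2 (of_int a)"
    unfolding abs2_mult[symmetric] ab(2) using ab(1) by simp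
  moreover have "abs2 (of_int b) \<noteq> 0" using ab(1) by simp
  ultimately show ?thesis unfolding norm2_of_int by (metis mult_right_cancel)
qed


section \<open>Fractional part and the additive character\<close>

definition I2_rat :: "rat set" where
  "I2_rat = {(\<Sum>i<\<gamma>. d i * 2 ^ i) / 2 ^ \<gamma> | \<gamma> d. \<gamma> \<ge> 1 \<and> (\<forall>i. d i \<in> {0, 1})}"

definition I2 :: "Q2 set" where
  "I2 = of_rat ` I2_rat"

text \<open>The part of the 2-adic digit expansion with negative exponents: the unique element of
  \<open>I2_rat\<close> congruent to \<open>t\<close> modulo the 2-adic integers.\<close>

definition frac2 :: "Q2 \<Rightarrow> rat" where
  "frac2 t = (THE r. r \<in> I2_rat \<and> norm2 (t - of_rat r) \<le> 1)"

definition chi2 :: "Q2 \<Rightarrow> complex" where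
  "chi2 t = exp (2 * complex_of_real pi * \<i> * of_rat (frac2 t))"


section \<open>Analysis on the n-dimensional 2-adic space\<close>

text \<open>The library's topology on \<^typ>\<open>Q2^'n\<close> is the product topology, which is also the
  topology of the maximum norm.\<close>

definition vnorm2 :: "Q2^'n \<Rightarrow> real" where
  "vnorm2 x = (MAX \<nu>. norm2 (x $ \<nu>))"

definition Z2n :: "(Q2^'n) set" where
  "Z2n = {x. vnorm2 x \<le> 1}"

definition dotp :: "Q2^'n \<Rightarrow> Q2^'n \<Rightarrow> Q2" where
  "dotp \<xi> x = (\<Sum>\<nu>\<in>UNIV. \<xi> $ \<nu> * x $ \<nu>)"

definition is_haar :: "(Q2^'n) measure \<Rightarrow> bool" where
  "is_haar \<mu> \<longleftrightarrow> sets \<mu> = sets borel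
     \<and> (\<forall>A \<in> sets borel. \<forall>a. emeasure \<mu> ((\<lambda>x. a + x) ` A) = emeasure \<mu> A)
     \<and> emeasure \<mu> Z2n = 1"

text \<open>By Haar's theorem there is exactly one such measure.\<close>

definition haar :: "(Q2^'n) measure" where
  "haar = (SOME \<mu>. is_haar \<mu>)"

definition fourier :: "(Q2^'n \<Rightarrow> complex) \<Rightarrow> Q2^'n \<Rightarrow> complex" where
  "fourier \<phi> \<xi> = (LINT x|haar. chi2 (dotp \<xi> x) * \<phi> x)"

definition inv_fourier :: "(Q2^'n \<Rightarrow> complex) \<Rightarrow> Q2^'n \<Rightarrow> complex" where
  "inv_fourier \<phi> x = (LINT \<xi>|haar. chi2 (dotp (- x) \<xi>) * \<phi> \<xi>)"

definition locally_constant_on :: "(Q2^'n) set \<Rightarrow> (Q2^'n \<Rightarrow> complex) \<Rightarrow> bool" where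
  "locally_constant_on U f \<longleftrightarrow> (\<forall>x\<in>U. \<forall>\<^sub>F y in at x within U. f y = f x)"

definition test_functions :: "(Q2^'n \<Rightarrow> complex) set" where
  "test_functions = {\<phi>. locally_constant_on UNIV \<phi> \<and> compact (closure {x. \<phi> x \<noteq> 0})}"

definition lizorkin :: "(Q2^'n \<Rightarrow> complex) set" where
  "lizorkin = {\<phi> \<in> test_functions. (LINT x|haar. \<phi> x) = 0}"

text \<open>Symbols live on the complement of the origin; their value at \<open>0\<close> is ignored.\<close>

definition pseudo_diff ::
  "(Q2^'n \<Rightarrow> complex) \<Rightarrow> (Q2^'n \<Rightarrow> complex) \<Rightarrow> Q2^'n \<Rightarrow> complex" where
  "pseudo_diff \<A> \<phi> = inv_fourier (\<lambda>\<xi>. if \<xi> = 0 then 0 else \<A> \<xi> * fourier \<phi> \<xi>)"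

text \<open>Operators are defined on the Lizorkin space, so eigenfunctions are required to lie in it.\<close>

definition eigenfunction ::
  "((Q2^'n \<Rightarrow> complex) \<Rightarrow> Q2^'n \<Rightarrow> complex) \<Rightarrow> (Q2^'n \<Rightarrow> complex) \<Rightarrow> bool" where
  "eigenfunction A f \<longleftrightarrow> f \<in> lizorkin \<and> f \<noteq> (\<lambda>x. 0) \<and> (\<exists>c. A f = (\<lambda>x. c * f x))"


section \<open>Wavelets\<close>

definition Omega :: "real \<Rightarrow> complex" where
  "Omega t = (if 0 \<le> t \<and> t \<le> 1 then 1 else 0)"

definition k_idx :: "'n set \<Rightarrow> 'n \<Rightarrow> nat" where
  "k_idx e \<nu> = (if \<nu> \<in> e then 1 else 0)"

definition k_vec :: "'n set \<Rightarrow> Q2^'n" where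
  "k_vec e = (\<chi> \<nu>. of_nat (k_idx e \<nu>))"

definition Psi0 :: "'n set \<Rightarrow> Q2^'n \<Rightarrow> complex" where
  "Psi0 e x = chi2 (inverse 2 * dotp (k_vec e) x) * Omega (vnorm2 x)"

text \<open>\<open>admissible s \<alpha>\<close> concerns one coordinate; \<open>\<alpha> i k\<close> is the coefficient with
  superscript \<open>i\<close> in \<open>{0, 1}\<close> and index \<open>k < 2 ^ s\<close>, all other values being irrelevant.\<close>

definition admissible :: "nat \<Rightarrow> (nat \<Rightarrow> nat \<Rightarrow> complex) \<Rightarrow> bool" where
  "admissible s \<alpha> \<longleftrightarrow>
     (\<forall>k<2^s. \<alpha> 0 k = (if k = 0 then 1 else 0)) \<and>
     (if s = 0 then \<alpha> 1 0 = 1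
      else \<exists>\<gamma>. (\<forall>r<2^s. cmod (\<gamma> r) = 1) \<and>
        (\<forall>k<2^s. \<alpha> 1 k = 1 / 2 ^ s * (- 1) ^ k *
           (\<Sum>r<2^s. \<gamma> r * exp (- (\<i> * complex_of_real pi * (of_nat (2 * r + 1) / 2 ^ s) * of_nat k)))))"

text \<open>The iterated sum over all \<open>r\<^sub>\<nu> < 2 ^ s\<^sub>\<nu>\<close> is a sum over a dependent product.\<close>

definition Psi ::
  "('n \<Rightarrow> nat) \<Rightarrow> ('n \<Rightarrow> nat \<Rightarrow> nat \<Rightarrow> complex) \<Rightarrow> 'n set \<Rightarrow> int \<Rightarrow> Q2^'n \<Rightarrow> Q2^'n \<Rightarrow> complex" where
  "Psi s \<alpha> e j a x =
     complex_of_real (2 powr (- (real CARD('n) * real_of_int j / 2))) *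
     (\<Sum>r \<in> (\<Pi>\<^sub>E \<nu>\<in>UNIV. {..<2 ^ s \<nu>}).
        (\<Prod>\<nu>\<in>UNIV. \<alpha> \<nu> (k_idx e \<nu>) (r \<nu>)) *
        Psi0 e ((2 powi j) *s x - a - (\<chi> \<nu>. of_nat (r \<nu>) / 2 ^ s \<nu> * of_nat (k_idx e \<nu>))))"

end

theory Submission
  imports Defs
begin

text \<open>
  Everything reduces to finite linear combinations of modulated indicator functions of cosets of
  the lattices \<open>2\<^sup>m\<int>\<^sub>2\<^sup>n\<close>: the Fourier transform and its inverse map such a function to another one explicitly,
  because the integral of a character over a lattice is its measure or zero. Hence both
  transforms are mutually inverse on these combinations, which exhaust the test functions.

  The transform of \<open>\<Psi>\<close> is supported on \<open>S = 2\<^sup>j(-k\<^sub>e/2 + \<int>\<^sub>2\<^sup>n)\<close>, and does not vanish there: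
  its factors are discrete Fourier transforms of the coefficients \<open>\<alpha>\<close>, which return unimodular
  parameters \<open>\<gamma>\<close>. Applying the forward transform to \<open>A \<Psi> = c \<Psi>\<close> gives \<open>\<A> = c\<close> on \<open>S\<close>.

  A Haar measure exists because binary digit reversal carries Lebesgue measure on the orthant
  \<open>[0, \<infinity>)\<^sup>n\<close> to a measure giving equal mass to all cosets of a lattice, and these cosets form a
  generator of the Borel sets that is stable under intersection.
\<close>

section \<open>The 2-adic norm\<close>

text \<open>The eigenvalue equation compares inverse transforms, while the criterion concerns single
  values of the symbol. The inverse transform can be stripped off because S is compact and, for
  nonempty e, avoids 0: the product of the symbol with the transform of Psi is then locally constant
  with support in S, hence a finite combination of modulated indicators. The transform must be
  nonzero at every point of S, since at a zero the equation says nothing about the symbol. S lies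
  around -k_e/2, not +k_e/2, because F uses the character with a plus sign and so moves a function
  of frequency w to a neighbourhood of -w. The half-odd exponents (2r+1)/2^s in the coefficients
  compensate this offset by one half: what remains is an ordinary discrete Fourier transform of
  length 2^s with whole frequencies. \<open>haar\<close> is a \<open>SOME\<close>-choice, so nothing
  is known about it before a Haar measure has been exhibited. From then on, invariance and the
  normalisation on \<open>Z2n\<close> fix the mass of every coset, because a lattice splits into 2^n
  cosets of the next finer one.\<close>

lemma norm2_0 [simp]: "norm2 0 = 0"
  by (simp add: norm2_eq_0)

lemma norm2_1 [simp]: "norm2 1 = 1"
  using norm2_of_nat[of 1] by simp

lemma norm2_inverse: "norm2 (inverse x) = inverse (norm2 x)"
proof (cases "x = 0")
  case False
  then have "norm2 x * norm2 (inverse x) = 1" by (simp flip: norm2_mult)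
  then show ?thesis by (metis inverse_unique)
qed auto

lemma norm2_2 [simp]: "norm2 2 = 1 / 2"
  using norm2_of_nat[of 2] abs2_divide[of 2 1]
  by (simp add: power_int_minus)

lemma norm2_power: "norm2 (x ^ n) = norm2 x ^ n"
  by (induction n) (auto simp: norm2_mult)

lemma norm2_powi: "norm2 (x powi k) = norm2 x powi k"
  by (cases "k \<ge> 0") (auto simp: power_int_def norm2_power norm2_inverse)

lemma norm2_2_powi [simp]: "norm2 (2 powi k) = 2 powi (- k)"
proof -
  have "norm2 (2 powi k) = inverse 2 powi k" by (simp add: norm2_powi inverse_eq_divide)
  also have "\<dots> = 2 powi (- k)" by (simp only: power_int_inverse power_int_minus)
  finally show ?thesis .
qed

lemma norm2_diff_commute: "norm2 (x - y) = norm2 (y - x)"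
  using norm2_minus[of "x - y"] by simp

lemma norm2_add_le: "norm2 x \<le> c \<Longrightarrow> norm2 y \<le> c \<Longrightarrow> norm2 (x + y) \<le> c"
  using norm2_ultrametric[of x y] by simp

lemma norm2_diff_le: "norm2 x \<le> c \<Longrightarrow> norm2 y \<le> c \<Longrightarrow> norm2 (x - y) \<le> c"
  using norm2_add_le[of x c "- y"] by (simp add: norm2_minus)

lemma norm2_sum_le:
  assumes "\<And>i. i \<in> I \<Longrightarrow> norm2 (f i) \<le> c" "c \<ge> 0"
  shows "norm2 (\<Sum>i\<in>I. f i) \<le> c"
  using assms by (induction I rule: infinite_finite_induct) (auto intro: norm2_add_le)

lemma norm2_of_int_le_1: "norm2 (of_int i) \<le> 1"
proof -
  have "abs2 (of_int i) \<le> 1"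
  proof (cases "i = 0")
    case False
    have "(2::real) powi (- int (multiplicity 2 i)) \<le> 2 powi 0"
      by (intro power_int_increasing) auto
    moreover have "abs2 (of_int i) = 2 powi (- int (multiplicity 2 i))"
      using abs2_divide[of i 1] False by (simp del: power_int_minus)
    ultimately show ?thesis by (simp only: power_int_0_right)
  qed simp
  then show ?thesis by (simp add: norm2_of_int)
qed

lemma norm2_of_nat_le_1: "norm2 (of_nat i) \<le> 1"
  using norm2_of_int_le_1[of "int i"] by simp

text \<open>A copy of \<open>of_rat\<close> that \<open>transfer\<close> unfolds to a constant
  sequence, so that limits can be compared with rationals.\<close>

lift_definition const_Q2 :: "rat \<Rightarrow> Q2" is "\<lambda>r _. r"
  by (simp add: Q2_rel_def)

lemma const_Q2_eq_of_rat: "const_Q2 r = of_rat r"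
proof -
  have add: "const_Q2 (x + y) = const_Q2 x + const_Q2 y" for x y
    by transfer (simp add: Q2_rel_def)
  have mult: "const_Q2 (x * y) = const_Q2 x * const_Q2 y" for x y
    by transfer (simp add: Q2_rel_def)
  have 1: "const_Q2 1 = 1" by transfer (simp add: Q2_rel_def)
  have 0: "const_Q2 0 = 0" by transfer (simp add: Q2_rel_def)
  have nat: "const_Q2 (of_nat n) = of_nat n" for n
    by (induction n) (simp_all add: 0 1 add)
  have minus: "const_Q2 (- x) = - const_Q2 x" for x
    using add[of x "- x"] 0 by (simp add: minus_unique)
  have int: "const_Q2 (of_int i) = of_int i" for i
  proof (cases i rule: int_diff_cases)
    case (diff m n)
    have "const_Q2 (of_nat m + - of_nat n) = of_nat m + - of_nat n"
      by (simp only: add minus nat)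
    then show ?thesis by (simp add: diff)
  qed
  obtain a b where ab: "b \<noteq> 0" "r = of_int a / of_int b" by (rule rat_as_fraction)
  have "const_Q2 r * of_int b = of_int a"
    using ab by (simp flip: int mult)
  then show ?thesis using ab(1) unfolding ab(2) by (simp add: of_rat_divide field_simps)
qed

text \<open>The norm of the difference is the limit of \<open>abs2 (X n - X N)\<close>, whose terms
  are eventually at most \<open>e\<close>. This error bound serves density, completeness and the
  Monna map.\<close>

lemma Q2_rat_limit:
  assumes "Cauchy2 X" "\<And>m n. N \<le> m \<Longrightarrow> N \<le> n \<Longrightarrow> abs2 (X m - X n) \<le> e"
  shows "norm2 (abs_Q2 X - of_rat (X N)) \<le> e"
proof -
  define x where "x = abs_Q2 X"
  have "Q2_rel X X" using assms(1) by (simp add: Q2_rel_def)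
  then have [transfer_rule]: "pcr_Q2 X x"
    unfolding Q2.pcr_cr_eq cr_Q2_def x_def by simp
  show ?thesis unfolding x_def[symmetric] const_Q2_eq_of_rat[symmetric] minus_Q2_def
  proof (transfer fixing: e X N)
    have C: "Cauchy2 (\<lambda>n. X n + - X N)" using assms(1) by (intro Cauchy2_add) auto
    have "abs2 (X n + - X N) \<le> e" if "n \<ge> N" for n
      using assms(2)[OF that, of N] by simp
    then show "lim (\<lambda>n. abs2 (X n + - X N)) \<le> e"
      by (intro LIMSEQ_le_const2[OF Cauchy2_tendsto[OF C]]) blast
  qed
qed

section \<open>The additive character\<close>

lemma powi2_le_iff [simp]: "(2::real) powi k \<le> 2 powi l \<longleftrightarrow> k \<le> l"
  using power_int_increasing[of k l "2::real"] power_int_strict_increasing[of l k "2::real"]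
  by linarith

lemma powi2_less_iff [simp]: "(2::real) powi k < 2 powi l \<longleftrightarrow> k < l"
  using powi2_le_iff[of l k] by (simp only: not_le[symmetric])

lemma powi2_eq_iff [simp]: "(2::real) powi k = 2 powi l \<longleftrightarrow> k = l"
  using powi2_le_iff[of l k] powi2_le_iff[of k l] by linarith

lemma norm2_divide: "norm2 (x / y) = norm2 x / norm2 y"
  by (simp add: divide_inverse norm2_mult norm2_inverse)

lemma Q2_rat_dense:
  assumes "e > 0"
  obtains r where "norm2 (x - of_rat r) < e"
proof -
  obtain X where abs_eq: "x = abs_Q2 X" and X: "Cauchy2 X"
    using Quotient3_abs_rep[OF Quotient3_Q2, of x] Quotient3_rep_reflp[OF Quotient3_Q2, of x]
    unfolding Q2_rel_def by metis
  obtain N where N: "\<forall>m\<ge>N. \<forall>n\<ge>N. abs2 (X m - X n) < e / 2"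
    using X \<open>e > 0\<close> unfolding Cauchy2_def by (meson half_gt_zero)
  have "norm2 (x - of_rat (X N)) \<le> e / 2"
    unfolding abs_eq by (rule Q2_rat_limit[OF X]) (use N in \<open>auto intro: less_imp_le\<close>)
  then show ?thesis using that[of "X N"] \<open>e > 0\<close> by simp
qed

text \<open>The isosceles triangle principle of ultrametric spaces.\<close>

lemma norm2_eqI:
  assumes "norm2 (x - y) < norm2 x"
  shows "norm2 x = norm2 y"
proof (rule antisym)
  show "norm2 x \<le> norm2 y"
    using norm2_ultrametric[of "x - y" y] assms by simp
  show "norm2 y \<le> norm2 x"
    using norm2_ultrametric[of "y - x" x] assms by (simp add: norm2_diff_commute[of y x])
qed

text \<open>Completion adds no new norms: a sufficiently close rational has the same norm by
  \<open>norm2_eqI\<close>.\<close>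

lemma norm2_value_group:
  assumes "x \<noteq> 0"
  obtains k :: int where "norm2 x = 2 powi k"
proof -
  have pos: "norm2 x > 0" using assms norm2_nonneg[of x] norm2_eq_0[of x] by linarith
  obtain r where r: "norm2 (x - of_rat r) < norm2 x" by (rule Q2_rat_dense[OF pos])
  then have "norm2 x = abs2 r" using norm2_eqI norm2_of_rat by metis
  with pos show ?thesis using that by (auto simp: abs2_def split: if_splits)
qed

lemma norm2_less_powi_iff: "norm2 x < 2 powi k \<longleftrightarrow> norm2 x \<le> 2 powi (k - 1)"
proof (cases "x = 0")
  case False
  then obtain l where l: "norm2 x = 2 powi l" by (rule norm2_value_group)
  show ?thesis unfolding l by auto
qed (auto simp: less_le)

lemma norm2_less_1_iff: "norm2 x < 1 \<longleftrightarrow> norm2 x \<le> 1 / 2"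
  using norm2_less_powi_iff[of x 0] by (simp add: power_int_minus inverse_eq_divide)

text \<open>The residue field has two elements. A unit is close to a rational p/q with p and q odd,
  and p/q - 1 = (p - q)/q has an even numerator.\<close>

lemma Q2_integer_residue:
  assumes "norm2 x \<le> 1"
  shows "norm2 x \<le> 1 / 2 \<or> norm2 (x - 1) \<le> 1 / 2"
proof (cases "norm2 x < 1")
  case False
  then have x: "norm2 x = 1" using assms by simp
  obtain r where r: "norm2 (x - of_rat r) < 1" by (rule Q2_rat_dense[of 1 x]) auto
  then have r1: "abs2 r = 1" using x norm2_eqI norm2_of_rat by metis
  obtain p q where pq: "quotient_of r = (p, q)" by fastforce
  have q: "q > 0" "coprime p q" and r_eq: "r = of_int p / of_int q"
    using pq quotient_of_denom_pos quotient_of_div quotient_of_coprime by blast+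
  have nz: "r \<noteq> 0" "p \<noteq> 0" using r1 r_eq by auto
  have "multiplicity 2 p = multiplicity 2 q"
    using r1 abs2_divide[of p q] nz q r_eq powi2_eq_iff[of _ 0] by auto
  \<comment> \<open>A positive common multiplicity would contradict coprimality.\<close>
  then have "odd p" "odd q"
    using q nz multiplicity_eq_zero_iff[of p 2] multiplicity_eq_zero_iff[of q 2]
      coprime_common_divisor[of p q 2] by auto
  then have ev: "even (p - q)" by simp
  have "norm2 (of_rat r - 1) \<le> 1 / 2"
  proof -
    obtain c where c: "p - q = 2 * c" using ev by blast
    have "of_rat r - 1 = 2 * of_int c * inverse (of_int q :: Q2)"
    proof -
      have p: "p = q + 2 * c" using c by simp
      show ?thesis unfolding r_eq p using q(1) by (simp add: of_rat_divide of_rat_add of_rat_mult field_simps)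
    qed
    moreover have "norm2 (of_int q) = 1"
      using \<open>odd q\<close> q abs2_divide[of q 1] by (simp add: norm2_of_int not_dvd_imp_multiplicity_0)
    ultimately show ?thesis using norm2_of_int_le_1[of c]
      by (simp add: norm2_mult norm2_inverse)
  qed
  then have "norm2 ((x - of_rat r) + (of_rat r - 1)) \<le> 1 / 2"
    using r by (intro norm2_add_le) (auto simp: norm2_less_1_iff)
  then show ?thesis by simp
qed (simp add: norm2_less_1_iff)

text \<open>Extracts binary digits: the next digit is the residue of the remainder after division by
  2^m.\<close>

lemma Q2_integer_residue_power:
  assumes "norm2 x \<le> 1"
  shows "\<exists>i<2 ^ m. norm2 (x - of_nat i) \<le> 1 / 2 ^ m"
proof (induction m)
  case (Suc m)
  then obtain i where i: "i < 2 ^ m" "norm2 (x - of_nat i) \<le> 1 / 2 ^ m" by blast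
  define y where "y = (x - of_nat i) * inverse 2 ^ m"
  have x: "x = of_nat i + 2 ^ m * y" by (simp add: y_def field_simps)
  have "norm2 y \<le> 1" using i(2)
    by (simp add: y_def norm2_mult norm2_divide norm2_power norm2_inverse field_simps power_divide)
  then consider "norm2 y \<le> 1 / 2" | "norm2 (y - 1) \<le> 1 / 2" using Q2_integer_residue by blast
  then show ?case
  proof cases
    case 1
    then have "norm2 (x - of_nat i) \<le> 1 / 2 ^ Suc m"
      by (simp add: x norm2_mult norm2_power power_one_over field_simps)
    then show ?thesis using i(1) by (intro exI[of _ i]) auto
  next
    case 2
    have "x - of_nat (i + 2 ^ m) = 2 ^ m * (y - 1)" by (simp add: x algebra_simps)
    then have "norm2 (x - of_nat (i + 2 ^ m)) \<le> 1 / 2 ^ Suc m"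
      using 2 by (simp only: norm2_mult norm2_power) (simp add: power_one_over field_simps)
    then show ?thesis using i(1) by (intro exI[of _ "i + 2 ^ m"]) auto
  qed
qed (use assms in auto)

lemma norm2_bounded_powi:
  obtains m :: nat where "norm2 x \<le> 2 ^ m"
  using real_arch_pow[of 2 "norm2 x"] by (meson less_imp_le one_less_numeral_iff semiring_norm(76))

text \<open>The denominator contains no prime but 2, so integrality at 2 is integrality. This is
  what makes fractional parts unique.\<close>

lemma dyadic_integer:
  assumes "norm2 (of_rat (of_int N / 2 ^ g)) \<le> 1"
  shows "(of_int N / 2 ^ g :: rat) \<in> \<int>"
proof (cases "N = 0")
  case False
  have "abs2 (of_int N / of_int (2 ^ g)) \<le> 1" using assms by (simp add: norm2_of_rat)
  then have "(2::real) powi (int g - int (multiplicity 2 N)) \<le> 2 powi 0"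
    using False by (subst (asm) abs2_divide) (auto simp: multiplicity_same_power)
  then have "g \<le> multiplicity 2 N"
    by (simp only: powi2_le_iff)
  then have "2 ^ g dvd N" using multiplicity_dvd' by blast
  then obtain c where "N = 2 ^ g * c" by blast
  then show ?thesis by simp
qed simp

lemma I2_rat_eq: "I2_rat = {of_nat N / 2 ^ g | N g. N < 2 ^ g}"
proof -
  have sum: "\<exists>N. (\<Sum>i<g. d i * 2 ^ i) = (of_nat N :: rat) \<and> N < 2 ^ g"
    if "\<forall>i. d i \<in> {0, 1 :: rat}" for d g
  proof (induction g)
    case (Suc g)
    then obtain N where N: "(\<Sum>i<g. d i * 2 ^ i) = (of_nat N :: rat)" "N < 2 ^ g" by blast
    have "d g \<in> {0, 1}" using that by simp
    then show ?case
    proof safe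
      assume "d g = 0"
      then show ?thesis using N by (intro exI[of _ N]) auto
    next
      assume "d g = 1"
      then show ?thesis using N by (intro exI[of _ "N + 2 ^ g"]) auto
    qed
  qed auto
  have digits: "\<exists>d. (\<forall>i. d i \<in> {0, 1}) \<and> (\<Sum>i<g. d i * 2 ^ i) = (of_nat N :: rat)"
    if "N < 2 ^ g" for N g
    using that
  proof (induction g arbitrary: N)
    case 0
    then show ?case by (intro exI[of _ "\<lambda>_. 0"]) auto
  next
    case (Suc g)
    then have "N mod 2 ^ g < 2 ^ g" by simp
    from Suc.IH[OF this] obtain d where
      d: "\<forall>i. d i \<in> {0, 1}" "(\<Sum>i<g. d i * 2 ^ i) = (of_nat (N mod 2 ^ g) :: rat)" by blast
    have "N div 2 ^ g < 2" using Suc.prems by (simp add: less_mult_imp_div_less)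
    then have "(of_nat (N div 2 ^ g) :: rat) \<in> {0, 1}" by auto
    moreover have "(of_nat N :: rat) = of_nat (N mod 2 ^ g) + of_nat (N div 2 ^ g) * 2 ^ g"
    proof -
      have "(of_nat N :: rat) = of_nat (N mod 2 ^ g + N div 2 ^ g * 2 ^ g)" by (simp only: mod_div_mult_eq)
      then show ?thesis by (simp only: of_nat_add of_nat_mult of_nat_power of_nat_numeral)
    qed
    ultimately show ?case using d
      by (intro exI[of _ "d(g := of_nat (N div 2 ^ g))"]) auto
  qed
  show ?thesis
  proof (intro set_eqI iffI)
    fix r assume "r \<in> I2_rat"
    then obtain g d where r: "r = (\<Sum>i<g. d i * 2 ^ i) / 2 ^ g" and d: "\<forall>i. d i \<in> {0, 1 :: rat}"
      unfolding I2_rat_def by blast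
    from sum[OF d, of g] obtain N where "(\<Sum>i<g. d i * 2 ^ i) = (of_nat N :: rat)" "N < 2 ^ g"
      by blast
    with r show "r \<in> {of_nat N / 2 ^ g | N g. N < 2 ^ g}" by auto
  next
    fix r :: rat assume "r \<in> {of_nat N / 2 ^ g | N g. N < 2 ^ g}"
    then obtain N g where N: "r = of_nat N / 2 ^ g" "N < 2 ^ g" by blast
    \<comment> \<open>\<open>I2_rat\<close> demands at least one digit while g may be 0, so the
      fraction is expanded by 2.\<close>
    then have "2 * N < 2 ^ Suc g" by simp
    from digits[OF this] obtain d where
      "\<forall>i. d i \<in> {0, 1}" "(\<Sum>i<Suc g. d i * 2 ^ i) = (of_nat (2 * N) :: rat)" by blast
    then show "r \<in> I2_rat" unfolding I2_rat_def N(1)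
      by (intro CollectI exI[of _ "Suc g"] exI[of _ d]) (auto simp: field_simps)
  qed
qed

lemma I2_rat_bounds:
  assumes "r \<in> I2_rat"
  shows "0 \<le> r" "r < 1"
proof -
  obtain N g where r: "r = of_nat N / 2 ^ g" "N < 2 ^ g"
    using assms unfolding I2_rat_eq by blast
  have "(of_nat N :: rat) < of_nat (2 ^ g)" using r(2) by (simp only: of_nat_less_iff)
  then show "0 \<le> r" "r < 1" unfolding r(1) by auto
qed

text \<open>The difference is a dyadic rational of norm at most 1, hence an integer, and lies
  strictly between -1 and 1.\<close>

lemma I2_rat_unique:
  assumes "r \<in> I2_rat" "q \<in> I2_rat" "norm2 (of_rat r - of_rat q) \<le> 1"
  shows "r = q"
proof -
  obtain N g M h where r: "r = of_nat N / 2 ^ g" "N < 2 ^ g" and q: "q = of_nat M / 2 ^ h" "M < 2 ^ h"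
    using assms unfolding I2_rat_eq by blast
  have *: "r - q = of_int (int N * 2 ^ h - int M * 2 ^ g) / 2 ^ (g + h)"
    unfolding r q by (simp add: field_simps power_add)
  have "r - q \<in> \<int>"
    using dyadic_integer[of "int N * 2 ^ h - int M * 2 ^ g" "g + h"] assms(3)
    unfolding * [symmetric] by (simp add: of_rat_diff)
  then obtain z where z: "r - q = of_int z" by (auto elim: Ints_cases)
  have "of_int z < (1::rat)" "of_int z > (-1::rat)"
    using z I2_rat_bounds[OF assms(1)] I2_rat_bounds[OF assms(2)] by linarith+
  then have "z = 0" by linarith
  then show ?thesis using z by simp
qed

lemma I2_rat_exists: "\<exists>r\<in>I2_rat. norm2 (x - of_rat r) \<le> 1"
proof -
  obtain m where m: "norm2 x \<le> 2 ^ m" by (rule norm2_bounded_powi)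
  then have "norm2 (2 ^ m * x) \<le> 1" by (simp add: norm2_mult norm2_power power_one_over)
  then obtain i where i: "i < 2 ^ m" "norm2 (2 ^ m * x - of_nat i) \<le> 1 / 2 ^ m"
    using Q2_integer_residue_power by blast
  have "x - of_rat (of_nat i / 2 ^ m) = (2 ^ m * x - of_nat i) * inverse 2 ^ m"
    by (simp add: of_rat_divide of_rat_power power_inverse field_simps)
  then have "norm2 (x - of_rat (of_nat i / 2 ^ m)) \<le> 1"
    using i by (simp only: norm2_mult norm2_power norm2_inverse) (simp add: field_simps)
  then show ?thesis using i(1) unfolding I2_rat_eq by blast
qed

lemma frac2_eqI:
  assumes "r \<in> I2_rat" "norm2 (x - of_rat r) \<le> 1"
  shows "frac2 x = r"
  unfolding frac2_def
proof (rule the_equality)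
  fix q assume q: "q \<in> I2_rat \<and> norm2 (x - of_rat q) \<le> 1"
  from assms(2) this have "norm2 ((x - of_rat r) - (x - of_rat q)) \<le> 1"
    by (rule norm2_diff_le[OF _ conjunct2])
  then have "norm2 (of_rat q - of_rat r) \<le> 1" by simp
  then show "q = r" using q assms by (intro I2_rat_unique) auto
qed (use assms in auto)

lemma frac2_in_I2_rat: "frac2 x \<in> I2_rat"
  and norm2_minus_frac2: "norm2 (x - of_rat (frac2 x)) \<le> 1"
  using I2_rat_exists[of x] frac2_eqI by metis+

text \<open>Any dyadic rational congruent to x may replace \<open>frac2 x\<close>: the two differ by
  an integer, which is a period of the exponential.\<close>

lemma chi2_eq_exp_dyadic:
  assumes "norm2 (x - of_rat (of_int N / 2 ^ g)) \<le> 1"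
  shows "chi2 x = exp (2 * complex_of_real pi * \<i> * (of_int N / 2 ^ g))"
proof -
  obtain M h where M: "frac2 x = of_nat M / 2 ^ h"
    using frac2_in_I2_rat[of x] unfolding I2_rat_eq by blast
  have *: "frac2 x - of_int N / 2 ^ g = of_int (int M * 2 ^ g - N * 2 ^ h) / 2 ^ (g + h)"
    unfolding M by (simp add: field_simps power_add)
  have "norm2 (of_rat (frac2 x - of_int N / 2 ^ g)) \<le> 1"
    using norm2_diff_le[OF assms norm2_minus_frac2[of x]] by (simp add: of_rat_diff)
  then have "frac2 x - of_int N / 2 ^ g \<in> \<int>"
    using dyadic_integer[of "int M * 2 ^ g - N * 2 ^ h" "g + h"] unfolding * by simp
  then obtain z where "frac2 x = of_int N / 2 ^ g + of_int z" by (metis Ints_cases diff_add_cancel add.commute)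
  then have "(of_rat (frac2 x) :: complex) = of_int N / 2 ^ g + of_int z"
    by (simp add: of_rat_add of_rat_divide of_rat_power)
  then have "2 * complex_of_real pi * \<i> * of_rat (frac2 x) =
      2 * complex_of_real pi * \<i> * (of_int N / 2 ^ g) + 2 * of_int z * complex_of_real pi * \<i>"
    by (simp add: algebra_simps)
  then show ?thesis unfolding chi2_def by (simp add: exp_eq)
qed

lemma chi2_add: "chi2 (x + y) = chi2 x * chi2 y"
proof -
  obtain M h where M: "frac2 x = of_nat M / 2 ^ h"
    using frac2_in_I2_rat[of x] unfolding I2_rat_eq by blast
  obtain N g where N: "frac2 y = of_nat N / 2 ^ g"
    using frac2_in_I2_rat[of y] unfolding I2_rat_eq by blast
  have *: "frac2 x + frac2 y = of_int (int M * 2 ^ g + int N * 2 ^ h) / 2 ^ (h + g)"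
    unfolding M N by (simp add: field_simps power_add)
  have "norm2 (x + y - of_rat (frac2 x + frac2 y)) \<le> 1"
    using norm2_add_le[OF norm2_minus_frac2[of x] norm2_minus_frac2[of y]]
    by (simp add: of_rat_add algebra_simps)
  then have "chi2 (x + y) = exp (2 * complex_of_real pi * \<i> *
      (of_int (int M * 2 ^ g + int N * 2 ^ h) / 2 ^ (h + g)))"
    unfolding * by (rule chi2_eq_exp_dyadic)
  also have "\<dots> = chi2 x * chi2 y"
    unfolding chi2_def M N exp_add[symmetric]
    by (rule arg_cong[of _ _ exp]) (simp add: field_simps of_rat_divide of_rat_power power_add)
  finally show ?thesis .
qed

lemma chi2_integer: "norm2 x \<le> 1 \<Longrightarrow> chi2 x = 1"
  using chi2_eq_exp_dyadic[of x 0 0] by simp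

lemma chi2_0 [simp]: "chi2 0 = 1"
  by (simp add: chi2_integer)

lemma chi2_neq_0 [simp]: "chi2 x \<noteq> 0"
  by (simp add: chi2_def)

lemma chi2_minus: "chi2 (- x) = inverse (chi2 x)"
  using chi2_add[of x "- x"] by (simp add: inverse_unique)

lemma chi2_sum: "chi2 (sum f I) = (\<Prod>i\<in>I. chi2 (f i))"
  by (induction I rule: infinite_finite_induct) (auto simp: chi2_add)

lemma norm_chi2 [simp]: "cmod (chi2 x) = 1"
proof -
  obtain N g where r: "frac2 x = of_nat N / 2 ^ g"
    using frac2_in_I2_rat[of x] unfolding I2_rat_eq by blast
  have "2 * complex_of_real pi * \<i> * of_rat (frac2 x) = \<i> * complex_of_real (2 * pi * (of_nat N / 2 ^ g))"
    unfolding r by (simp add: of_rat_divide of_rat_power)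
  then show ?thesis unfolding chi2_def by (simp only: norm_exp_i_times)
qed

lemma chi2_half: "chi2 (inverse 2) = -1"
  using chi2_eq_exp_dyadic[of "inverse 2" 1 1]
  by (simp add: of_rat_divide inverse_eq_divide exp_Euler)

section \<open>Topology\<close>

text \<open>Rationals chosen within 1/(n+1) of the n-th term form a Cauchy sequence, and its class
  is the limit.\<close>

instance Q2 :: complete_space
proof
  fix x :: "nat \<Rightarrow> Q2" assume "Cauchy x"
  have "\<exists>r. norm2 (x n - of_rat r) < 1 / real (Suc n)" for n
    by (rule Q2_rat_dense[of "1 / real (Suc n)" "x n"]) auto
  then obtain q where q: "\<And>n. norm2 (x n - of_rat (q n)) < 1 / real (Suc n)" by metis
  have close: "\<exists>N. \<forall>n\<ge>N. norm2 (x n - of_rat (q n)) \<le> e" if "e > 0" for e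
  proof -
    obtain N where N: "1 / real (Suc N) < e" using \<open>e > 0\<close> by (meson nat_approx_posE)
    have "norm2 (x n - of_rat (q n)) \<le> e" if "n \<ge> N" for n
    proof -
      have "1 / real (Suc n) \<le> 1 / real (Suc N)" using that by (intro divide_left_mono) auto
      then show ?thesis using q[of n] N by linarith
    qed
    then show ?thesis by blast
  qed
  have tail: "\<exists>N. \<forall>m\<ge>N. norm2 (x m - of_rat (q m)) \<le> e \<and> (\<forall>n\<ge>N. abs2 (q m - q n) \<le> e)"
    if "e > 0" for e
  proof -
    obtain N where N: "\<forall>n\<ge>N. norm2 (x n - of_rat (q n)) \<le> e" using close \<open>e > 0\<close> by blast
    obtain M where M: "\<And>m n. m \<ge> M \<Longrightarrow> n \<ge> M \<Longrightarrow> dist (x m) (x n) < e"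
      using \<open>Cauchy x\<close> \<open>e > 0\<close> unfolding Cauchy_def by blast
    have "abs2 (q m - q n) \<le> e" if mn: "m \<ge> max M N" "n \<ge> max M N" for m n
    proof -
      have "norm2 (x m - x n) \<le> e" using M[of m n] mn by (simp add: dist_Q2_def)
      moreover have "norm2 (x m - of_rat (q m)) \<le> e" "norm2 (x n - of_rat (q n)) \<le> e"
        using N mn by auto
      ultimately have "norm2 ((x m - x n) - (x m - of_rat (q m)) + (x n - of_rat (q n))) \<le> e"
        by (meson norm2_diff_le norm2_add_le)
      also have "(x m - x n) - (x m - of_rat (q m)) + (x n - of_rat (q n)) = of_rat (q m - q n)"
        by (simp add: of_rat_diff)
      finally show ?thesis by (simp add: norm2_of_rat)
    qed
    then show ?thesis using N by (intro exI[of _ "max M N"]) simp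
  qed
  have C: "Cauchy2 q" unfolding Cauchy2_def
  proof (intro allI impI)
    fix e :: real assume "e > 0"
    then have "e / 2 > 0" by simp
    from tail[OF this] obtain N where "\<forall>m\<ge>N. \<forall>n\<ge>N. abs2 (q m - q n) \<le> e / 2" by blast
    then show "\<exists>N. \<forall>m\<ge>N. \<forall>n\<ge>N. abs2 (q m - q n) < e" using \<open>e > 0\<close>
      by (metis field_sum_of_halves less_add_same_cancel1 half_gt_zero order.strict_trans1)
  qed
  have "x \<longlonglongrightarrow> abs_Q2 q"
  proof (rule metric_LIMSEQ_I)
    fix e :: real assume e: "e > 0"
    then have "e / 2 > 0" by simp
    from tail[OF this] obtain N where
      N: "\<And>m. m \<ge> N \<Longrightarrow> norm2 (x m - of_rat (q m)) \<le> e / 2"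
        "\<And>m n. m \<ge> N \<Longrightarrow> n \<ge> N \<Longrightarrow> abs2 (q m - q n) \<le> e / 2" by blast
    have "dist (x n) (abs_Q2 q) < e" if "n \<ge> N" for n
    proof -
      have "norm2 (abs_Q2 q - of_rat (q n)) \<le> e / 2"
        by (rule Q2_rat_limit[OF C]) (use that N(2) in auto)
      with N(1)[OF that] have "norm2 ((x n - of_rat (q n)) - (abs_Q2 q - of_rat (q n))) \<le> e / 2"
        by (rule norm2_diff_le)
      then show ?thesis using e by (simp add: dist_Q2_def)
    qed
    then show "\<exists>N. \<forall>n\<ge>N. dist (x n) (abs_Q2 q) < e" by blast
  qed
  then show "convergent x" by (rule convergentI)
qed

lemma compact_cball_Q2: "compact (cball (0::Q2) (2 ^ M))"
  unfolding compact_eq_totally_bounded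
proof (intro conjI allI impI)
  show "complete (cball (0::Q2) (2 ^ M))" by (simp add: complete_eq_closed)
  fix e :: real assume "e > 0"
  then obtain m where m: "1 / 2 ^ m < e" using real_arch_pow_inv[of e "1/2"] by (auto simp: power_one_over)
  \<comment> \<open>Division by 2^M magnifies distances by 2^M, so residues modulo 2^(m + M) are
    needed to approximate within 2^(-m).\<close>
  define c :: "nat \<Rightarrow> Q2" where "c i = of_nat i / 2 ^ M" for i
  have "\<exists>i<2 ^ (m + M). x \<in> ball (c i) e" if x: "x \<in> cball 0 (2 ^ M)" for x
  proof -
    have "norm2 x \<le> 2 ^ M" using x by (simp add: dist_Q2_def norm2_minus)
    then have "norm2 (2 ^ M * x) \<le> 1" by (simp add: norm2_mult norm2_power power_one_over)
    then obtain i where i: "i < 2 ^ (m + M)" "norm2 (2 ^ M * x - of_nat i) \<le> 1 / 2 ^ (m + M)"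
      using Q2_integer_residue_power by blast
    have "c i - x = - ((2 ^ M * x - of_nat i) / 2 ^ M)" by (simp add: c_def field_simps)
    then have "norm2 (c i - x) = norm2 (2 ^ M * x - of_nat i) * 2 ^ M"
      by (simp only: norm2_minus norm2_divide norm2_power) (simp add: power_one_over)
    also have "\<dots> \<le> 1 / 2 ^ (m + M) * 2 ^ M" using i(2) by (intro mult_right_mono) auto
    also have "\<dots> < e" using m by (simp add: power_add)
    finally show ?thesis using i(1) by (auto simp: dist_Q2_def)
  qed
  then have cover: "cball 0 (2 ^ M) \<subseteq> (\<Union>x\<in>c ` {..<2 ^ (m + M)}. ball x e)" by blast
  show "\<exists>k. finite k \<and> cball (0::Q2) (2 ^ M) \<subseteq> (\<Union>x\<in>k. ball x e)"
    using cover by blast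
qed

text \<open>Finite vectors inherit this class, which makes bounded closed sets of
  \<open>Q2^'n\<close> compact.\<close>

instance Q2 :: heine_borel
proof
  fix f :: "nat \<Rightarrow> Q2" assume "bounded (range f)"
  then obtain b where b: "\<And>n. dist 0 (f n) \<le> b" unfolding bounded_any_center[of _ 0] by auto
  obtain M where "b < 2 ^ M" using real_arch_pow[of 2 b] by auto
  then have "f n \<in> cball 0 (2 ^ M)" for n using b[of n] by simp
  moreover have "seq_compact (cball (0::Q2) (2 ^ M))"
    using compact_cball_Q2 compact_imp_seq_compact by blast
  ultimately show "\<exists>l r. strict_mono (r::nat\<Rightarrow>nat) \<and> ((f \<circ> r) \<longlongrightarrow> l) sequentially"
    unfolding seq_compact_def by meson
qed

section \<open>Lattices and their cosets as balls of the maximum norm\<close>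

definition lattice2 :: "int \<Rightarrow> (Q2^'n) set" where
  "lattice2 m = {x. \<forall>\<nu>. norm2 (x $ \<nu>) \<le> 2 powi (- m)}"

lemma vnorm2_le_iff: "vnorm2 x \<le> c \<longleftrightarrow> (\<forall>\<nu>. norm2 (x $ \<nu>) \<le> c)"
  unfolding vnorm2_def by (subst Max_le_iff) auto

lemma vnorm2_nonneg: "vnorm2 x \<ge> 0"
proof -
  have "norm2 (x $ undefined) \<le> vnorm2 x" using vnorm2_le_iff[of x "vnorm2 x"] by blast
  then show ?thesis using norm2_nonneg[of "x $ undefined"] by linarith
qed

lemma Z2n_eq_lattice2: "Z2n = lattice2 0"
  by (simp add: Z2n_def lattice2_def vnorm2_le_iff)

lemma lattice2_0 [simp]: "0 \<in> lattice2 m"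
  by (simp add: lattice2_def)

lemma lattice2_add: "x \<in> lattice2 m \<Longrightarrow> y \<in> lattice2 m \<Longrightarrow> x + y \<in> lattice2 m"
  by (simp add: lattice2_def norm2_add_le)

lemma lattice2_diff: "x \<in> lattice2 m \<Longrightarrow> y \<in> lattice2 m \<Longrightarrow> x - y \<in> lattice2 m"
  by (simp add: lattice2_def norm2_diff_le)

lemma lattice2_minus_iff [simp]: "- x \<in> lattice2 m \<longleftrightarrow> x \<in> lattice2 m"
  by (simp add: lattice2_def norm2_minus)

lemma lattice2_diff_commute: "x - y \<in> lattice2 m \<longleftrightarrow> y - x \<in> lattice2 m"
  using lattice2_minus_iff[of "x - y" m] by (simp only: minus_diff_eq)

lemma lattice2_trans: "x - y \<in> lattice2 m \<Longrightarrow> y - z \<in> lattice2 m \<Longrightarrow> x - z \<in> lattice2 m"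
  using lattice2_add[of "x - y" m "y - z"] by simp

lemma lattice2_antimono: "m \<le> m' \<Longrightarrow> x \<in> lattice2 m' \<Longrightarrow> x \<in> lattice2 m"
  unfolding lattice2_def by (auto intro: order.trans)

lemma lattice2_scale: "(2 powi j) *s x \<in> lattice2 m \<longleftrightarrow> x \<in> lattice2 (m - j)"
proof -
  have "norm2 (2 powi j * t) \<le> 2 powi (- m) \<longleftrightarrow> norm2 t \<le> 2 powi (- (m - j))" for t
  proof -
    have eq: "(2::real) powi (- (m - j)) = 2 powi j * 2 powi (- m)"
      by (simp flip: power_int_add)
    have cancel: "inverse p * n \<le> q \<longleftrightarrow> n \<le> p * q" if "p > 0" for p n q :: real
      using that by (simp add: field_simps)
    show ?thesis
      unfolding norm2_mult norm2_2_powi eq power_int_minus[of 2 j] by (rule cancel) simp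
  qed
  then show ?thesis by (simp add: lattice2_def)
qed

definition coset2 :: "int \<Rightarrow> Q2^'n \<Rightarrow> (Q2^'n) set" where
  "coset2 m u = {x. x - u \<in> lattice2 m}"

lemma coset2_self [simp]: "u \<in> coset2 m u"
  by (simp add: coset2_def)

lemma coset2_eqI:
  assumes "x \<in> coset2 m u"
  shows "coset2 m x = coset2 m u"
  using assms unfolding coset2_def by (auto intro: lattice2_trans simp: lattice2_diff_commute[of x u])

lemma coset2_0: "coset2 m 0 = lattice2 m"
  by (simp add: coset2_def)

lemma coset2_antimono: "m \<le> m' \<Longrightarrow> coset2 m' u \<subseteq> coset2 m u"
  by (auto simp: coset2_def intro: lattice2_antimono)

lemma translate_coset2: "x + a \<in> coset2 m u \<longleftrightarrow> x \<in> coset2 m (u - a)"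
  by (simp add: coset2_def algebra_simps)

text \<open>The ultrametric dichotomy: two balls are disjoint, or the smaller lies inside the
  larger.\<close>

lemma coset2_nested:
  assumes "m \<le> m'"
  shows "coset2 m u \<inter> coset2 m' v = {} \<or> coset2 m u \<inter> coset2 m' v = coset2 m' v"
proof (cases "v \<in> coset2 m u")
  case True
  have "coset2 m' v \<subseteq> coset2 m v" using assms by (rule coset2_antimono)
  then show ?thesis using coset2_eqI[OF True] by auto
next
  case False
  have "x \<notin> coset2 m u" if "x \<in> coset2 m' v" for x
  proof
    assume x: "x \<in> coset2 m u"
    have "x \<in> coset2 m v" using that coset2_antimono[OF assms] by blast
    then have "coset2 m v = coset2 m u" using coset2_eqI[OF x] coset2_eqI by metis
    then show False using False coset2_self by blast
  qed
  then show ?thesis by blast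
qed

lemma open_norm2_le: "open {y::Q2. norm2 (y - c) \<le> 2 powi k}"
  unfolding open_dist
proof (intro ballI exI conjI allI impI)
  fix x y assume x: "x \<in> {y. norm2 (y - c) \<le> 2 powi k}" and y: "dist y x < 2 powi k"
  have "norm2 ((y - x) + (x - c)) \<le> 2 powi k"
    using x y by (intro norm2_add_le) (auto simp: dist_Q2_def)
  then show "y \<in> {y. norm2 (y - c) \<le> 2 powi k}" by simp
qed simp

lemma open_coset2: "open (coset2 m u)"
  unfolding open_vec_def
proof (intro ballI)
  fix x assume "x \<in> coset2 m u"
  then show "\<exists>A. (\<forall>i. open (A i) \<and> x $ i \<in> A i) \<and> (\<forall>y. (\<forall>i. y $ i \<in> A i) \<longrightarrow> y \<in> coset2 m u)"
    by (intro exI[of _ "\<lambda>i. {y. norm2 (y - u $ i) \<le> 2 powi (- m)}"])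
       (auto simp: coset2_def lattice2_def open_norm2_le)
qed

lemma closed_coset2: "closed (coset2 m u)"
proof -
  have disj: "coset2 m x \<subseteq> - coset2 m u" if "x \<in> - coset2 m u" for x
  proof
    fix y assume y: "y \<in> coset2 m x"
    show "y \<in> - coset2 m u"
    proof
      assume "y \<in> coset2 m u"
      then have "coset2 m x = coset2 m u" using coset2_eqI[OF y] coset2_eqI by metis
      then show False using that coset2_self[of x m] by simp
    qed
  qed
  have "- coset2 m u = (\<Union>x\<in>- coset2 m u. coset2 m x)"
  proof
    show "- coset2 m u \<subseteq> (\<Union>x\<in>- coset2 m u. coset2 m x)"
      by (meson UN_iff coset2_self subsetI)
    show "(\<Union>x\<in>- coset2 m u. coset2 m x) \<subseteq> - coset2 m u"
      by (rule UN_least) (rule disj)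
  qed
  moreover have "open (\<Union>x\<in>- coset2 m u. coset2 m x)"
    by (intro open_UN ballI open_coset2)
  ultimately show ?thesis unfolding closed_def by (rule ssubst)
qed

lemma coset2_nhds_base:
  assumes "open S" "x \<in> S"
  obtains m where "coset2 m x \<subseteq> S"
proof -
  obtain A where A: "\<And>i. open (A i)" "\<And>i. x $ i \<in> A i" "\<And>y. (\<forall>i. y $ i \<in> A i) \<Longrightarrow> y \<in> S"
    using assms unfolding open_vec_def by metis
  have "\<exists>d>0. \<forall>y. dist y (x $ i) < d \<longrightarrow> y \<in> A i" for i
    using A(1,2) unfolding open_dist by blast
  then obtain d where d: "\<And>i. d i > 0" "\<And>i y. dist y (x $ i) < d i \<Longrightarrow> y \<in> A i" by metis
  obtain m where m: "1 / 2 ^ m < Min (range d)"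
    using real_arch_pow_inv[of "Min (range d)" "1/2"] d(1) by (auto simp: power_one_over)
  have "coset2 (int m) x \<subseteq> S"
  proof
    fix y assume y: "y \<in> coset2 (int m) x"
    have "dist (y $ i) (x $ i) < d i" for i
    proof -
      have "dist (y $ i) (x $ i) \<le> 1 / 2 ^ m"
        using y by (auto simp: coset2_def lattice2_def dist_Q2_def power_int_minus inverse_eq_divide)
      also have "\<dots> < Min (range d)" by (rule m)
      also have "\<dots> \<le> d i" by simp
      finally show ?thesis .
    qed
    then show "y \<in> S" using A(3) d(2) by blast
  qed
  then show ?thesis using that by blast
qed

lemma compact_coset2: "compact (coset2 m u :: (Q2^'n) set)"
  unfolding compact_eq_bounded_closed
proof
  have "dist x u \<le> (\<Sum>i\<in>(UNIV::'n set). 2 powi (- m))" if "x \<in> coset2 m u" for x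
  proof -
    have "dist x u \<le> (\<Sum>i\<in>UNIV. dist (x $ i) (u $ i))"
      unfolding dist_vec_def by (rule L2_set_le_sum) simp
    also have "\<dots> \<le> (\<Sum>i\<in>(UNIV::'n set). 2 powi (- m))"
      using that by (intro sum_mono) (auto simp: coset2_def lattice2_def dist_Q2_def)
    finally show ?thesis .
  qed
  then show "bounded (coset2 m u :: (Q2^'n) set)" unfolding bounded_def by (metis dist_commute)
qed (rule closed_coset2)

text \<open>Any point of a coset may serve as its centre, and by density a rational one
  exists.\<close>

lemma countable_cosets2: "countable (range (\<lambda>(m, u). coset2 m (u :: Q2^'n)))"
proof -
  have "\<exists>q. coset2 m u = coset2 m (\<chi> \<nu>. of_rat (q $ \<nu>))" for m and u :: "Q2^'n"
  proof -
    have "\<exists>r. norm2 (u $ \<nu> - of_rat r) \<le> 2 powi (- m)" for \<nu>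
      using Q2_rat_dense[of "2 powi (- m)" "u $ \<nu>"] by (auto intro: less_imp_le)
    then obtain r where "\<And>\<nu>. norm2 (u $ \<nu> - of_rat (r \<nu>)) \<le> 2 powi (- m)" by metis
    then have "u \<in> coset2 m (\<chi> \<nu>. of_rat ((\<chi> \<nu>. r \<nu>) $ \<nu>))"
      by (simp add: coset2_def lattice2_def)
    then show ?thesis using coset2_eqI by blast
  qed
  then have "range (\<lambda>(m, u). coset2 m (u :: Q2^'n)) \<subseteq>
      range (\<lambda>(m, q :: rat^'n). coset2 m (\<chi> \<nu>. of_rat (q $ \<nu>)))" by fastforce
  then show ?thesis by (rule countable_subset) auto
qed

lemma topological_basis_cosets2: "topological_basis (range (\<lambda>(m, u). coset2 m (u :: Q2^'n)))"
proof (rule topological_basisI)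
  fix S :: "(Q2^'n) set" and x assume "open S" "x \<in> S"
  then obtain m where "coset2 m x \<subseteq> S" by (rule coset2_nhds_base)
  then show "\<exists>B'\<in>range (\<lambda>(m, u). coset2 m u). x \<in> B' \<and> B' \<subseteq> S"
    by (intro bexI[of _ "coset2 m x"]) auto
qed (auto simp: open_coset2)

lemma borel_eq_cosets2: "borel = sigma UNIV (range (\<lambda>(m, u). coset2 m (u :: Q2^'n)))"
  by (rule borel_eq_countable_basis[OF countable_cosets2 topological_basis_cosets2])

lemma UN_lattice2: "(\<Union>i::nat. lattice2 (- int i)) = (UNIV :: (Q2^'n) set)"
proof -
  have "\<exists>i. x \<in> lattice2 (- int i)" for x :: "Q2^'n"
  proof -
    obtain i where "vnorm2 x < 2 ^ i" using real_arch_pow[of 2 "vnorm2 x"] by auto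
    then have "vnorm2 x \<le> 2 ^ i" by simp
    then show ?thesis unfolding vnorm2_le_iff lattice2_def by (auto simp: power_int_minus)
  qed
  then show ?thesis by blast
qed

text \<open>Uniqueness of measures on a generator; the lattices of negative level exhaust the space
  by sets of finite mass.\<close>

lemma measure_eqI_cosets2:
  fixes M N :: "(Q2^'n) measure"
  assumes sets: "sets M = sets borel" "sets N = sets borel"
    and eq: "\<And>m u. emeasure M (coset2 m u) = emeasure N (coset2 m u)"
    and fin: "\<And>m. emeasure M (lattice2 m) \<noteq> \<infinity>"
  shows "M = N"
proof -
  define C where "C = range (\<lambda>(m, u). coset2 m (u :: Q2^'n))"
  \<comment> \<open>Disjoint cosets meet in the empty set, which is not itself a coset.\<close>
  define E where "E = insert {} C"
  have borelE: "sets borel = sigma_sets UNIV E"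
  proof -
    have "sets borel = sigma_sets UNIV C" unfolding borel_eq_cosets2 C_def by simp
    also have "\<dots> = sigma_sets UNIV E"
      unfolding E_def
      by (intro sigma_sets_eqI) (auto intro: sigma_sets.Empty sigma_sets.Basic)
    finally show ?thesis .
  qed
  show ?thesis
  proof (rule measure_eqI_generator_eq[where E = E and \<Omega> = UNIV])
    have inC: "coset2 m u \<in> C" for m u unfolding C_def by auto
    have "A \<inter> B \<in> E" if AB: "A \<in> C" "B \<in> C" for A B
    proof -
      obtain m u m' v where *: "A = coset2 m u" "B = coset2 m' v" using AB unfolding C_def by auto
      show ?thesis
        using coset2_nested[of m m' u v] coset2_nested[of m' m v u] inC linear[of m m']
        unfolding E_def * by (metis Int_commute insert_iff)
    qed
    then show "Int_stable E" unfolding Int_stable_def E_def by auto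
    show "range (\<lambda>i. lattice2 (- int i)) \<subseteq> E"
      using inC unfolding E_def coset2_0[symmetric] by auto
    show "(\<Union>i. lattice2 (- int i)) = (UNIV :: (Q2^'n) set)" by (rule UN_lattice2)
  qed (use sets borelE eq fin in \<open>auto simp: E_def C_def\<close>)
qed

section \<open>Existence of Haar measure\<close>

text \<open>The base-2 radical inverse of van der Corput: the binary digit of weight 2^i receives
  weight 2^(-i-1). The lemmas below make it a bijection from \<open>nat\<close> onto
  \<open>I2_rat\<close>.\<close>

fun bitrev :: "nat \<Rightarrow> rat" where
  "bitrev n = (if n = 0 then 0 else (of_nat (n mod 2) + bitrev (n div 2)) / 2)"

declare bitrev.simps [simp del]

lemma bitrev_0 [simp]: "bitrev 0 = 0"
  by (simp add: bitrev.simps)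

lemma bitrev_step: "bitrev n = (of_nat (n mod 2) + bitrev (n div 2)) / 2"
  by (cases "n = 0") (simp_all add: bitrev.simps[of n])

lemma bitrev_in_I2_rat: "bitrev n \<in> I2_rat"
proof (induction n rule: less_induct)
  case (less n)
  show ?case
  proof (cases "n = 0")
    case False
    then have "bitrev (n div 2) \<in> I2_rat" by (intro less.IH) auto
    then obtain M g where M: "bitrev (n div 2) = of_nat M / 2 ^ g" "M < 2 ^ g"
      unfolding I2_rat_eq by blast
    have "bitrev n = of_nat ((n mod 2) * 2 ^ g + M) / 2 ^ Suc g"
      unfolding bitrev_step[of n] M(1) by (simp add: field_simps)
    moreover have "n mod 2 = 0 \<or> n mod 2 = 1" by auto
    then have "(n mod 2) * 2 ^ g + M < 2 ^ Suc g" using M(2) by auto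
    ultimately show ?thesis unfolding I2_rat_eq by blast
  qed (auto simp: I2_rat_eq intro: exI[of _ 0])
qed

lemma bitrev_surj: "N < 2 ^ g \<Longrightarrow> \<exists>n. bitrev n = of_nat N / 2 ^ g"
proof (induction g arbitrary: N)
  case 0
  then show ?case by (intro exI[of _ 0]) auto
next
  case (Suc g)
  \<comment> \<open>The leading digit of N becomes the lowest digit of the preimage.\<close>
  define b where "b = N div 2 ^ g"
  have b: "b < 2" using Suc.prems unfolding b_def by (simp add: less_mult_imp_div_less)
  obtain n where n: "bitrev n = of_nat (N mod 2 ^ g) / 2 ^ g" using Suc.IH[of "N mod 2 ^ g"] by auto
  have "(of_nat N :: rat) = of_nat (N mod 2 ^ g + b * 2 ^ g)"
    unfolding b_def by (simp only: mod_div_mult_eq)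
  then have N: "(of_nat N :: rat) = of_nat (N mod 2 ^ g) + of_nat b * 2 ^ g"
    by (simp only: of_nat_add of_nat_mult of_nat_power of_nat_numeral)
  have "(2 * n + b) mod 2 = b" "(2 * n + b) div 2 = n" using b by auto
  then have "bitrev (2 * n + b) = (of_nat b + bitrev n) / 2"
    using bitrev_step[of "2 * n + b"] by simp
  also have "\<dots> = of_nat N / 2 ^ Suc g" unfolding n N by (simp add: field_simps)
  finally show ?case by blast
qed

lemma bitrev_pos: "n > 0 \<Longrightarrow> bitrev n > 0"
proof (induction n rule: less_induct)
  case (less n)
  show ?case
  proof (cases "even n")
    case True
    then have "bitrev (n div 2) > 0" using less.prems by (intro less.IH) auto
    then show ?thesis using bitrev_step[of n] by (simp add: add_nonneg_pos)
  next
    case False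
    then show ?thesis using bitrev_step[of n] I2_rat_bounds(1)[OF bitrev_in_I2_rat[of "n div 2"]]
      by (simp add: odd_iff_mod_2_eq_one)
  qed
qed

text \<open>The lowest digit of n is the integer part of twice the value, because the remaining
  reversal lies in [0, 1).\<close>

lemma bitrev_inj: "bitrev n = bitrev m \<Longrightarrow> n = m"
proof (induction n arbitrary: m rule: less_induct)
  case (less n)
  show ?case
  proof (cases "n = 0")
    case True
    then show ?thesis using less.prems bitrev_pos[of m] by (cases "m = 0") auto
  next
    case False
    have eq: "of_nat (n mod 2) + bitrev (n div 2) = of_nat (m mod 2) + bitrev (m div 2)"
      using less.prems bitrev_step[of n] bitrev_step[of m] by simp
    have bounds: "0 \<le> bitrev k" "bitrev k < 1" for k
      using I2_rat_bounds[OF bitrev_in_I2_rat] by auto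
    have "n mod 2 = 0 \<or> n mod 2 = 1" "m mod 2 = 0 \<or> m mod 2 = 1" by auto
    then have mod: "n mod 2 = m mod 2"
      using eq bounds[of "n div 2"] bounds[of "m div 2"] by auto
    then have "bitrev (n div 2) = bitrev (m div 2)" using eq by simp
    then have "n div 2 = m div 2" using False by (intro less.IH) auto
    then show ?thesis using mod by (metis div_mult_mod_eq)
  qed
qed

text \<open>The floor keeps the binary digits of t down to weight 2^(-m). The factor 2^m undoes the
  scaling, so the digit of weight 2^i lands at 2^(-i-1) whatever m is, and passing to m + 1 merely
  adds one digit at 2^m.\<close>

definition monna_approx :: "int \<Rightarrow> real \<Rightarrow> rat" where
  "monna_approx m t = 2 powi m * bitrev (nat \<lfloor>2 powi m * t\<rfloor>)"

text \<open>The inverse of the Monna map: it reverses the binary expansion of \<open>t \<ge> 0\<close> about the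
  binary point, so that dyadic intervals correspond to 2-adic balls of the same measure.\<close>

definition monna :: "real \<Rightarrow> Q2" where
  "monna t = abs_Q2 (\<lambda>n. monna_approx (int n) t)"

lemma of_rat_2_powi: "of_rat (2 powi m) = (2 powi m :: Q2)"
  by (cases "m \<ge> 0") (simp_all add: power_int_def of_rat_power of_rat_divide)

lemma abs2_2_powi [simp]: "abs2 (2 powi m) = 2 powi (- m)"
  by (simp add: of_rat_2_powi flip: norm2_of_rat)

lemma monna_approx_step:
  assumes "t \<ge> 0"
  shows "abs2 (monna_approx (m + 1) t - monna_approx m t) \<le> 2 powi (- m)"
proof -
  define n where "n = nat \<lfloor>2 powi (m + 1) * t\<rfloor>"
  have p: "(2::real) powi (m + 1) * t = 2 * (2 powi m * t)" by (simp add: power_int_add_1)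
  have half: "\<lfloor>x\<rfloor> = \<lfloor>2 * x\<rfloor> div 2" for x :: real
    by (rule floor_unique) linarith+
  have "nat \<lfloor>2 powi m * t\<rfloor> = n div 2"
    unfolding n_def p half[of "2 powi m * t"] by (simp add: nat_div_distrib)
  moreover have p2: "(2::rat) powi (m + 1) = 2 * 2 powi m" by (simp add: power_int_add_1)
  ultimately have "monna_approx (m + 1) t - monna_approx m t = 2 powi m * of_nat (n mod 2)"
    unfolding monna_approx_def n_def[symmetric]
    by (subst bitrev_step[of n]) (simp only: p2, simp add: field_simps)
  moreover have "n mod 2 = 0 \<or> n mod 2 = 1" by auto
  ultimately show ?thesis by auto
qed

lemma monna_approx_diff:
  assumes "t \<ge> 0" "m \<le> m'"
  shows "abs2 (monna_approx m' t - monna_approx m t) \<le> 2 powi (- m)"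
  using assms(2)
proof (induction m' rule: int_ge_induct)
  case (step i)
  have "abs2 (monna_approx (i + 1) t - monna_approx i t) \<le> 2 powi (- i)"
    by (rule monna_approx_step[OF assms(1)])
  also have "\<dots> \<le> 2 powi (- m)" using step.hyps by simp
  finally show ?case
    using abs2_ultrametric[of "monna_approx (i + 1) t - monna_approx i t" "monna_approx i t - monna_approx m t"]
      step.IH by simp
qed simp

lemma monna_approximation:
  assumes "t \<ge> 0"
  shows "norm2 (monna t - of_rat (monna_approx m t)) \<le> 2 powi (- m)"
proof -
  define X where "X = (\<lambda>n. monna_approx (int n) t)"
  have X: "abs2 (X k - X l) \<le> 2 powi (- int N)" if "N \<le> k" "N \<le> l" for k l N
    using abs2_ultrametric[of "X k - X N" "X N - X l"] that abs2_minus_commute[of "X N" "X l"]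
      monna_approx_diff[OF assms, of "int N" "int k"] monna_approx_diff[OF assms, of "int N" "int l"]
    unfolding X_def by simp
  have "Cauchy2 X" unfolding Cauchy2_def
  proof (intro allI impI)
    fix e :: real assume "e > 0"
    then obtain N where "(1/2) ^ N < e" using real_arch_pow_inv[of e "1/2"] by auto
    then have "2 powi (- int N) < e" by (simp add: power_int_minus power_one_over inverse_eq_divide)
    then show "\<exists>N. \<forall>m\<ge>N. \<forall>n\<ge>N. abs2 (X m - X n) < e" using X by (meson order.strict_trans1)
  qed
  \<comment> \<open>The sequence defining \<open>monna\<close> has only levels from 0 on, while m
    may be negative.\<close>
  define N where "N = nat (max m 0)"
  have "norm2 (monna t - of_rat (X N)) \<le> 2 powi (- int N)"
    unfolding monna_def X_def[symmetric] by (rule Q2_rat_limit[OF \<open>Cauchy2 X\<close> X])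
  also have "\<dots> \<le> 2 powi (- m)" by (simp add: N_def)
  finally have "norm2 (monna t - of_rat (X N)) \<le> 2 powi (- m)" .
  moreover have "norm2 (of_rat (X N) - of_rat (monna_approx m t)) \<le> 2 powi (- m)"
    using monna_approx_diff[OF assms, of m "int N"]
    unfolding X_def of_rat_diff[symmetric] norm2_of_rat by (simp add: N_def)
  ultimately have "norm2 ((monna t - of_rat (X N)) + (of_rat (X N) - of_rat (monna_approx m t))) \<le> 2 powi (- m)"
    by (rule norm2_add_le)
  then show ?thesis by simp
qed

text \<open>Precision m decides membership in a ball of radius 2^(-m). After scaling by 2^(-m) the
  approximation is \<open>bitrev n\<close>, which must equal the fractional part of the scaled
  centre; injectivity then fixes the floor of 2^m t.\<close>

lemma monna_ball:
  obtains N :: nat where "\<And>t. t \<ge> 0 \<Longrightarrow>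
    norm2 (monna t - u) \<le> 2 powi (- m) \<longleftrightarrow> real N / 2 powi m \<le> t \<and> t < (real N + 1) / 2 powi m"
proof -
  define w where "w = 2 powi (- m) * u"
  obtain K g where "frac2 w = of_nat K / 2 ^ g" "K < 2 ^ g"
    using frac2_in_I2_rat[of w] unfolding I2_rat_eq by blast
  then obtain N where N: "bitrev N = frac2 w" using bitrev_surj by metis
  have "norm2 (monna t - u) \<le> 2 powi (- m) \<longleftrightarrow> real N / 2 powi m \<le> t \<and> t < (real N + 1) / 2 powi m"
    if t: "t \<ge> 0" for t
  proof -
    define n where "n = nat \<lfloor>2 powi m * t\<rfloor>"
    have pw: "2 powi m * (2 powi (- m) * x) = x" for x :: Q2 by (simp add: power_int_minus)
    have "norm2 (monna t - u) \<le> 2 powi (- m) \<longleftrightarrow>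
        norm2 (of_rat (monna_approx m t) - u) \<le> 2 powi (- m)"
      using norm2_diff_le[OF _ monna_approximation[OF t, of m], of "monna t - u"]
        norm2_add_le[OF _ monna_approximation[OF t, of m], of "of_rat (monna_approx m t) - u"]
      by auto
    also have "of_rat (monna_approx m t) - u = 2 powi m * (of_rat (bitrev n) - w)"
      unfolding w_def monna_approx_def n_def right_diff_distrib pw
      by (simp add: of_rat_mult of_rat_2_powi)
    also have "norm2 \<dots> \<le> 2 powi (- m) \<longleftrightarrow> norm2 (of_rat (bitrev n) - w) \<le> 1"
      unfolding norm2_mult norm2_2_powi by simp
    also have "\<dots> \<longleftrightarrow> frac2 w = bitrev n"
      using frac2_eqI[OF bitrev_in_I2_rat, of w n] norm2_minus_frac2[of w]
      by (auto simp: norm2_diff_commute)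
    also have "\<dots> \<longleftrightarrow> n = N" using N bitrev_inj by metis
    also have "\<dots> \<longleftrightarrow> \<lfloor>2 powi m * t\<rfloor> = int N" using t unfolding n_def by auto
    also have "\<dots> \<longleftrightarrow> real N \<le> 2 powi m * t \<and> 2 powi m * t < real N + 1"
      by (simp add: floor_eq_iff)
    also have "\<dots> \<longleftrightarrow> real N / 2 powi m \<le> t \<and> t < (real N + 1) / 2 powi m"
      by (simp add: field_simps)
    finally show ?thesis .
  qed
  then show ?thesis using that by blast
qed

text \<open>Squeezed between the open and the closed box of equal volume. The half-open shape comes
  from the floor in \<open>monna_approx\<close>.\<close>

lemma emeasure_half_open_cube:
  fixes a :: "real^'n"
  assumes "c \<ge> 0"
  shows "{t. \<forall>\<nu>. a $ \<nu> \<le> t $ \<nu> \<and> t $ \<nu> < a $ \<nu> + c} \<in> sets lborel" (is "?H \<in> _")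
    and "emeasure lborel {t. \<forall>\<nu>. a $ \<nu> \<le> t $ \<nu> \<and> t $ \<nu> < a $ \<nu> + c} = ennreal (c ^ CARD('n))"
proof -
  have nth: "(\<lambda>t :: real^'n. t $ \<nu>) \<in> borel_measurable borel" for \<nu>
    by (intro borel_measurable_continuous_onI continuous_intros)
  have "?H = (\<Inter>\<nu>\<in>UNIV. {t. a $ \<nu> \<le> t $ \<nu>} \<inter> {t. t $ \<nu> < a $ \<nu> + c})" by auto
  also have "\<dots> \<in> sets borel"
    using nth by (intro sets.finite_INT sets.Int) (auto intro: borel_measurable_le borel_measurable_less)
  finally show H: "?H \<in> sets lborel" by simp
  define b where "b = a + (\<chi> \<nu>. c)"
  have inner: "(b - a) \<bullet> k = c" "a \<bullet> k \<le> b \<bullet> k" if "k \<in> Basis" for k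
    using that assms by (auto simp: b_def Basis_vec_def inner_axis inner_add_left)
  have "(\<Prod>k\<in>Basis. (b - a) \<bullet> k) = c ^ CARD('n)" using inner(1) by simp
  then have meas: "emeasure lborel (box a b) = ennreal (c ^ CARD('n))"
      "emeasure lborel (cbox a b) = ennreal (c ^ CARD('n))"
    using inner(2) by (simp_all add: emeasure_lborel_cbox_eq)
  have "box a b \<subseteq> ?H" "?H \<subseteq> cbox a b"
    by (simp_all add: b_def mem_box_cart subset_iff less_imp_le)
  then have "emeasure lborel (box a b) \<le> emeasure lborel ?H" "emeasure lborel ?H \<le> emeasure lborel (cbox a b)"
    using H by (auto intro!: emeasure_mono)
  then show "emeasure lborel ?H = ennreal (c ^ CARD('n))" using meas by simp
qed

text \<open>On negative reals \<open>nat\<close> truncates the floor to 0 and \<open>monna\<close>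
  collapses to 0, so the measure is pushed forward from here only.\<close>

definition orthant :: "(real^'n) set" where
  "orthant = {t. \<forall>\<nu>. 0 \<le> t $ \<nu>}"

definition monna_vec :: "real^'n \<Rightarrow> Q2^'n" where
  "monna_vec t = (\<chi> \<nu>. monna (t $ \<nu>))"

lemma monna_vec_vimage:
  obtains a where "{t \<in> orthant. monna_vec t \<in> coset2 m (u :: Q2^'n)} =
    {t. \<forall>\<nu>. a $ \<nu> \<le> t $ \<nu> \<and> t $ \<nu> < a $ \<nu> + 2 powi (- m)}"
proof -
  have "\<exists>N::nat. \<forall>t\<ge>0. norm2 (monna t - u $ \<nu>) \<le> 2 powi (- m) \<longleftrightarrow>
      real N / 2 powi m \<le> t \<and> t < (real N + 1) / 2 powi m" for \<nu>
    using monna_ball by metis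
  then obtain N :: "'n \<Rightarrow> nat" where N: "\<And>\<nu> t. t \<ge> 0 \<Longrightarrow> norm2 (monna t - u $ \<nu>) \<le> 2 powi (- m) \<longleftrightarrow>
      real (N \<nu>) / 2 powi m \<le> t \<and> t < (real (N \<nu>) + 1) / 2 powi m" by metis
  define a :: "real^'n" where "a = (\<chi> \<nu>. real (N \<nu>) / 2 powi m)"
  have "(t \<in> orthant \<and> monna_vec t \<in> coset2 m u) \<longleftrightarrow>
      (\<forall>\<nu>. a $ \<nu> \<le> t $ \<nu> \<and> t $ \<nu> < a $ \<nu> + 2 powi (- m))" for t
  proof -
    have "a $ \<nu> \<ge> 0" for \<nu> by (simp add: a_def)
    then have "(\<forall>\<nu>. a $ \<nu> \<le> t $ \<nu> \<and> t $ \<nu> < a $ \<nu> + 2 powi (- m)) \<longleftrightarrow>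
        (\<forall>\<nu>. 0 \<le> t $ \<nu> \<and> a $ \<nu> \<le> t $ \<nu> \<and> t $ \<nu> < a $ \<nu> + 2 powi (- m))"
      by (meson order.trans)
    also have "\<dots> \<longleftrightarrow> (\<forall>\<nu>. 0 \<le> t $ \<nu> \<and> norm2 (monna (t $ \<nu>) - u $ \<nu>) \<le> 2 powi (- m))"
      using N by (auto simp: a_def add_divide_distrib power_int_minus inverse_eq_divide)
    finally show ?thesis by (auto simp: orthant_def monna_vec_def coset2_def lattice2_def)
  qed
  then show ?thesis using that by blast
qed

lemma orthant_borel: "orthant \<in> sets (lborel :: (real^'n) measure)"
proof -
  have nth: "(\<lambda>t :: real^'n. t $ \<nu>) \<in> borel_measurable borel" for \<nu>
    by (intro borel_measurable_continuous_onI continuous_intros)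
  have "orthant = (\<Inter>\<nu>\<in>UNIV. {t :: real^'n. 0 \<le> t $ \<nu>})" by (auto simp: orthant_def)
  also have "\<dots> \<in> sets borel"
    using nth by (intro sets.finite_INT) (auto intro: borel_measurable_le)
  finally show ?thesis by simp
qed

definition monna_measure :: "(Q2^'n) measure" where
  "monna_measure = distr (restrict_space lborel orthant) borel monna_vec"

lemma monna_vec_measurable: "monna_vec \<in> restrict_space lborel (orthant :: (real^'n) set) \<rightarrow>\<^sub>M borel"
  unfolding borel_eq_cosets2
proof (rule measurable_measure_of)
  fix A :: "(Q2^'n) set" assume "A \<in> range (\<lambda>(m, u). coset2 m u)"
  then obtain m u where A: "A = coset2 m u" by auto
  obtain a where a: "{t \<in> orthant. monna_vec t \<in> coset2 m u} =
    {t. \<forall>\<nu>. a $ \<nu> \<le> t $ \<nu> \<and> t $ \<nu> < a $ \<nu> + 2 powi (- m)}" by (rule monna_vec_vimage)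
  have "monna_vec -` A \<inter> space (restrict_space lborel orthant) =
      orthant \<inter> {t \<in> orthant. monna_vec t \<in> coset2 m u}"
    by (auto simp: A space_restrict_space)
  also have "\<dots> \<in> sets (restrict_space lborel orthant)"
    unfolding a sets_restrict_space by (intro imageI emeasure_half_open_cube(1)) simp
  finally show "monna_vec -` A \<inter> space (restrict_space lborel orthant) \<in> sets (restrict_space lborel orthant)" .
qed auto

lemma emeasure_monna_measure_coset2:
  "emeasure (monna_measure :: (Q2^'n) measure) (coset2 m u) = ennreal ((2 powi (- m)) ^ CARD('n))"
proof -
  obtain a where a: "{t \<in> orthant. monna_vec t \<in> coset2 m u} =
    {t. \<forall>\<nu>. a $ \<nu> \<le> t $ \<nu> \<and> t $ \<nu> < a $ \<nu> + 2 powi (- m)}" by (rule monna_vec_vimage)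
  have "emeasure monna_measure (coset2 m u) =
      emeasure (restrict_space lborel orthant) (monna_vec -` coset2 m u \<inter> space (restrict_space lborel orthant))"
    unfolding monna_measure_def
    by (rule emeasure_distr[OF monna_vec_measurable]) (simp add: open_coset2)
  also have "monna_vec -` coset2 m u \<inter> space (restrict_space lborel orthant) =
      {t \<in> orthant. monna_vec t \<in> coset2 m u}"
    by (auto simp: space_restrict_space)
  also have "emeasure (restrict_space lborel orthant) \<dots> = emeasure lborel \<dots>"
    using orthant_borel by (intro emeasure_restrict_space) auto
  also have "\<dots> = ennreal ((2 powi (- m)) ^ CARD('n))"
    unfolding a by (rule emeasure_half_open_cube(2)) simp
  finally show ?thesis .
qed

lemma translation_measurable: "(\<lambda>x :: Q2^'n. x + a) \<in> borel \<rightarrow>\<^sub>M borel"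
  unfolding borel_eq_cosets2 [of, symmetric]
proof (subst (2) borel_eq_cosets2, rule measurable_measure_of)
  fix A :: "(Q2^'n) set" assume "A \<in> range (\<lambda>(m, u). coset2 m u)"
  then obtain m u where A: "A = coset2 m u" by auto
  have "(\<lambda>x. x + a) -` A \<inter> space borel = coset2 m (u - a)"
    unfolding A by (auto simp: translate_coset2)
  then show "(\<lambda>x. x + a) -` A \<inter> space borel \<in> sets borel" by (simp add: open_coset2)
qed auto

lemma is_haar_monna_measure: "is_haar (monna_measure :: (Q2^'n) measure)"
  unfolding is_haar_def
proof (intro conjI ballI allI)
  show sets: "sets monna_measure = sets (borel :: (Q2^'n) measure)" by (simp add: monna_measure_def)
  show "emeasure (monna_measure :: (Q2^'n) measure) Z2n = 1"
    unfolding Z2n_eq_lattice2 coset2_0[symmetric] emeasure_monna_measure_coset2 by simp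
  fix A :: "(Q2^'n) set" and a assume A: "A \<in> sets borel"
  \<comment> \<open>The preimage of A under the shift by -a is the translate a + A. Since the mass
    of a coset depends only on its level, the pushforward agrees with the measure on cosets.\<close>
  let ?T = "\<lambda>x :: Q2^'n. x + (- a)"
  have T: "?T \<in> monna_measure \<rightarrow>\<^sub>M borel"
    unfolding measurable_cong_sets[OF sets refl] by (rule translation_measurable)
  have emeas: "emeasure (distr monna_measure borel ?T) B = emeasure monna_measure {x. ?T x \<in> B}"
    if "B \<in> sets borel" for B
  proof -
    have "space (monna_measure :: (Q2^'n) measure) = UNIV" by (simp add: monna_measure_def)
    then show ?thesis unfolding emeasure_distr[OF T that] vimage_def by simp
  qed
  have "distr monna_measure borel ?T = monna_measure"
  proof (rule measure_eqI_cosets2)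
    fix m and u :: "Q2^'n"
    have "{x. ?T x \<in> coset2 m u} = coset2 m (u - (- a))" by (simp only: translate_coset2 Collect_mem_eq)
    then show "emeasure (distr monna_measure borel ?T) (coset2 m u) = emeasure monna_measure (coset2 m u)"
      by (simp only: emeas borel_open[OF open_coset2] emeasure_monna_measure_coset2)
    show "emeasure (distr monna_measure borel ?T) (lattice2 m) \<noteq> \<infinity>"
    proof -
      have "{x. ?T x \<in> coset2 m 0} = coset2 m (0 - (- a))" by (simp only: translate_coset2 Collect_mem_eq)
      then have "emeasure (distr monna_measure borel ?T) (coset2 m 0) = ennreal ((2 powi (- m)) ^ CARD('n))"
        by (simp only: emeas borel_open[OF open_coset2] emeasure_monna_measure_coset2)
      then show ?thesis unfolding coset2_0 by simp
    qed
  qed (simp_all add: sets)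
  moreover have "(\<lambda>x. a + x) ` A = {x. ?T x \<in> A}"
    by (force simp: image_iff)
  ultimately show "emeasure monna_measure ((\<lambda>x. a + x) ` A) = emeasure monna_measure A"
    using emeas[OF A] by simp
qed

lemma is_haar_haar: "is_haar haar"
  unfolding haar_def using is_haar_monna_measure by (rule someI)

section \<open>Fourier transform of modulated coset indicators\<close>

lemma sets_haar [simp, measurable_cong]: "sets haar = sets borel"
  and haar_translate: "A \<in> sets borel \<Longrightarrow> emeasure haar ((\<lambda>x. a + x) ` A) = emeasure haar A"
  and haar_Z2n: "emeasure haar Z2n = 1"
  using is_haar_haar unfolding is_haar_def by auto

lemma space_haar [simp]: "space haar = UNIV"
  using sets_eq_imp_space_eq[OF sets_haar] by simp

lemma translation_measurable_haar [measurable]: "(\<lambda>x. x + a) \<in> haar \<rightarrow>\<^sub>M borel"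
  unfolding measurable_cong_sets[OF sets_haar refl] by (rule translation_measurable)

lemma distr_haar_translate: "distr haar borel (\<lambda>x. x + a) = haar"
proof (rule measure_eqI)
  fix A assume "A \<in> sets (distr haar borel (\<lambda>x. x + a))"
  then have A: "A \<in> sets borel" by simp
  have "emeasure (distr haar borel (\<lambda>x. x + a)) A = emeasure haar {x. x + a \<in> A}"
    by (subst emeasure_distr[OF translation_measurable_haar A]) (simp add: vimage_def)
  also have "{x. x + a \<in> A} = (\<lambda>x. - a + x) ` A"
    by (force simp: image_iff)
  finally show "emeasure (distr haar borel (\<lambda>x. x + a)) A = emeasure haar A"
    by (simp only: haar_translate[OF A])
qed simp

lemma haar_integral_translate:
  fixes f :: "Q2^'n \<Rightarrow> complex"
  assumes "f \<in> borel_measurable borel"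
  shows "(LINT x|haar. f (x + a)) = (LINT x|haar. f x)"
proof -
  have "(LINT x|haar. f x) = (LINT x|distr haar borel (\<lambda>x. x + a). f x)"
    by (simp only: distr_haar_translate)
  also have "\<dots> = (LINT x|haar. f (x + a))"
    by (rule integral_distr[OF translation_measurable_haar assms])
  finally show ?thesis ..
qed

lemma coset2_borel [measurable, simp]: "coset2 m u \<in> sets borel"
  by (simp add: open_coset2)

lemma emeasure_haar_coset2: "emeasure haar (coset2 m (u :: Q2^'n)) = emeasure haar (lattice2 m :: (Q2^'n) set)"
proof -
  have eq: "(\<lambda>x. u + x) ` lattice2 m = coset2 m u"
    by (force simp: coset2_def image_iff)
  then show ?thesis
    using haar_translate[OF coset2_borel[of m 0], of u] by (simp only: coset2_0 eq)
qed

section \<open>Haar measure of lattices and cosets\<close>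

lemma k_vec_nth [simp]: "k_vec e $ \<nu> = (if \<nu> \<in> e then 1 else 0)"
  by (simp add: k_vec_def k_idx_def)

text \<open>The subsets \<open>d\<close> of the index set enumerate the residues modulo \<open>2\<close>.\<close>

lemma lattice2_decompose:
  "lattice2 m = (\<Union>d. coset2 (m + 1) ((2 powi m) *s k_vec d :: Q2^'n))"
  and coset2_residues_disjoint:
  "disjoint_family_on (\<lambda>d. coset2 (m + 1) ((2 powi m) *s k_vec d :: Q2^'n)) UNIV"
proof -
  have inv: "(2 powi m) *s ((2 powi (- m)) *s x) = x" for x :: "Q2^'n"
    by (simp add: power_int_minus vec_eq_iff)
  show "lattice2 m = (\<Union>d. coset2 (m + 1) ((2 powi m) *s k_vec d :: Q2^'n))"
  proof (intro set_eqI iffI)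
    fix x :: "Q2^'n" assume x: "x \<in> lattice2 m"
    define y where "y = (2 powi (- m)) *s x"
    have y: "y \<in> lattice2 0" using x unfolding y_def lattice2_scale by simp
    \<comment> \<open>The coordinates whose residue modulo 2 is 1.\<close>
    define d where "d = {\<nu>. \<not> norm2 (y $ \<nu>) \<le> 1 / 2}"
    have "y - k_vec d \<in> lattice2 1"
      using y Q2_integer_residue by (auto simp: lattice2_def d_def power_int_minus)
    then have "(2 powi m) *s (y - k_vec d) \<in> lattice2 (m + 1)" unfolding lattice2_scale by simp
    then have "x \<in> coset2 (m + 1) ((2 powi m) *s k_vec d)"
      unfolding coset2_def y_def vector_ssub_ldistrib inv by simp
    then show "x \<in> (\<Union>d. coset2 (m + 1) ((2 powi m) *s k_vec d))" by blast
  next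
    fix x :: "Q2^'n" assume "x \<in> (\<Union>d. coset2 (m + 1) ((2 powi m) *s k_vec d))"
    then obtain d where d: "x - (2 powi m) *s k_vec d \<in> lattice2 (m + 1)" by (auto simp: coset2_def)
    have "k_vec d \<in> lattice2 0" by (simp add: lattice2_def)
    then have "(2 powi m) *s k_vec d \<in> (lattice2 m :: (Q2^'n) set)" unfolding lattice2_scale by simp
    moreover have "x - (2 powi m) *s k_vec d \<in> lattice2 m" using d by (rule lattice2_antimono[rotated]) simp
    ultimately have "(x - (2 powi m) *s k_vec d) + (2 powi m) *s k_vec d \<in> lattice2 m" by (intro lattice2_add)
    then show "x \<in> lattice2 m" by simp
  qed
  show "disjoint_family_on (\<lambda>d. coset2 (m + 1) ((2 powi m) *s k_vec d :: Q2^'n)) UNIV"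
    unfolding disjoint_family_on_def
  proof (intro ballI impI, rule ccontr)
    fix d d' :: "'n set"
    assume "d \<noteq> d'" and "coset2 (m + 1) ((2 powi m) *s k_vec d) \<inter> coset2 (m + 1) ((2 powi m) *s k_vec d') \<noteq> {}"
    then obtain x :: "Q2^'n" where "x - (2 powi m) *s k_vec d \<in> lattice2 (m + 1)"
        "x - (2 powi m) *s k_vec d' \<in> lattice2 (m + 1)" by (auto simp: coset2_def)
    then have "(2 powi m) *s k_vec d - (2 powi m) *s k_vec d' \<in> (lattice2 (m + 1) :: (Q2^'n) set)"
      using lattice2_trans lattice2_diff_commute by blast
    then have "k_vec d - k_vec d' \<in> (lattice2 1 :: (Q2^'n) set)"
      unfolding vector_ssub_ldistrib[symmetric] lattice2_scale by simp
    then have "norm2 (k_vec d $ \<nu> - k_vec d' $ \<nu>) \<le> 1 / 2" for \<nu>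
      by (simp add: lattice2_def power_int_minus)
    then have le: "norm2 (k_vec d $ \<nu> - k_vec d' $ \<nu>) \<le> 1 / 2" for \<nu> .
    obtain \<nu> where \<nu>: "\<nu> \<in> d \<longleftrightarrow> \<nu> \<notin> d'" using \<open>d \<noteq> d'\<close> by blast
    then have "norm2 (k_vec d $ \<nu> - k_vec d' $ \<nu>) = 1"
      by (cases "\<nu> \<in> d") (auto simp: norm2_minus)
    then show False using le[of \<nu>] by simp
  qed
qed

text \<open>The next lattice has index 2^n, and its cosets have equal mass by invariance.\<close>

lemma emeasure_haar_lattice2_step:
  "emeasure haar (lattice2 m :: (Q2^'n) set) = 2 ^ CARD('n) * emeasure haar (lattice2 (m + 1) :: (Q2^'n) set)"
proof -
  have "emeasure haar (lattice2 m :: (Q2^'n) set) =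
      (\<Sum>d\<in>UNIV. emeasure haar (coset2 (m + 1) ((2 powi m) *s k_vec d :: Q2^'n)))"
    unfolding lattice2_decompose[of m]
    by (rule sum_emeasure[symmetric]) (auto intro: coset2_residues_disjoint)
  also have "\<dots> = of_nat (card (UNIV :: 'n set set)) * emeasure haar (lattice2 (m + 1) :: (Q2^'n) set)"
    by (simp only: emeasure_haar_coset2 sum_constant)
  also have "card (UNIV :: 'n set set) = 2 ^ CARD('n)"
    using card_Pow[of "UNIV :: 'n set"] by simp
  finally show ?thesis by simp
qed

lemma emeasure_haar_lattice2:
  "emeasure haar (lattice2 m :: (Q2^'n) set) = ennreal ((2 powi (- m)) ^ CARD('n))"
proof (induction m rule: int_induct[of _ 0])
  case base
  then show ?case using haar_Z2n by (simp add: Z2n_eq_lattice2)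
next
  case (step1 i)
  have "(2 powi (- i)) ^ CARD('n) = (2::real) ^ CARD('n) * (2 powi (- (i + 1))) ^ CARD('n)"
    unfolding power_mult_distrib[symmetric] by (simp add: power_int_diff)
  then have "2 ^ CARD('n) * emeasure haar (lattice2 (i + 1) :: (Q2^'n) set) =
      2 ^ CARD('n) * ennreal ((2 powi (- (i + 1))) ^ CARD('n))"
    unfolding emeasure_haar_lattice2_step[symmetric] step1 by (simp add: ennreal_mult ennreal_power[symmetric])
  \<comment> \<open>The factor is neither zero nor infinite, so it cancels in
    \<open>ennreal\<close>.\<close>
  then show ?case by (auto simp: ennreal_mult_cancel_left power_eq_top_ennreal)
next
  case (step2 i)
  have "(2 powi (- (i - 1))) ^ CARD('n) = (2::real) ^ CARD('n) * (2 powi (- i)) ^ CARD('n)"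
    unfolding power_mult_distrib[symmetric] by (simp add: power_int_diff power_int_minus field_simps)
  then show ?case
    using emeasure_haar_lattice2_step[of "i - 1", where 'n = 'n] step2
    by (simp add: ennreal_mult ennreal_power[symmetric])
qed

text \<open>The \<open>itself\<close> argument carries the dimension, which the level and the real
  result do not mention.\<close>

definition vol2 :: "'n itself \<Rightarrow> int \<Rightarrow> real" where
  "vol2 _ m = (2 powi (- m)) ^ CARD('n)"

lemma vol2_pos: "vol2 TYPE('n) m > 0"
  by (simp add: vol2_def)

lemma vol2_minus [simp]: "vol2 TYPE('n) m * vol2 TYPE('n) (- m) = 1"
  by (simp add: vol2_def power_int_minus flip: power_mult_distrib)

lemma emeasure_coset2_finite [simp]: "emeasure haar (coset2 m u :: (Q2^'n) set) < top"
  by (simp add: emeasure_haar_coset2 emeasure_haar_lattice2)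

lemma measure_haar_coset2: "measure haar (coset2 m u :: (Q2^'n) set) = vol2 TYPE('n) m"
  by (simp add: measure_def emeasure_haar_coset2 emeasure_haar_lattice2 vol2_def)

section \<open>Characters and dual lattices\<close>

lemma dotp_commute: "dotp x y = dotp y x"
  by (simp add: dotp_def mult.commute)

lemma dotp_add_right: "dotp w (x + y) = dotp w x + dotp w y"
  by (simp add: dotp_def distrib_left sum.distrib)

lemma dotp_add_left: "dotp (x + y) w = dotp x w + dotp y w"
  by (simp add: dotp_def distrib_right sum.distrib)

lemma dotp_minus_right [simp]: "dotp w (- x) = - dotp w x"
  by (simp add: dotp_def sum_negf)

lemma dotp_minus_left [simp]: "dotp (- w) x = - dotp w x"
  by (simp add: dotp_def sum_negf)

lemma dotp_diff_right: "dotp w (x - y) = dotp w x - dotp w y"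
  using dotp_add_right[of w x "- y"] by simp

lemma dotp_diff_left: "dotp (x - y) w = dotp x w - dotp y w"
  using dotp_add_left[of x "- y" w] by simp

lemma chi2_diff: "chi2 (x - y) = chi2 x * chi2 (- y)"
  using chi2_add[of x "- y"] by simp

lemma dotp_0 [simp]: "dotp 0 x = 0" "dotp w 0 = 0"
  by (simp_all add: dotp_def)

lemma dotp_scale_right: "dotp w (c *s x) = c * dotp w x"
  by (simp add: dotp_def sum_distrib_left mult_ac)

lemma dotp_scale_left: "dotp (c *s w) x = c * dotp w x"
  by (simp add: dotp_def sum_distrib_left mult_ac)

text \<open>The lattices of levels m and -m are dual: their elements pair to 2-adic
  integers.\<close>

lemma chi2_dotp_dual:
  assumes "w \<in> lattice2 (- m)" "x \<in> lattice2 m"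
  shows "chi2 (dotp w x) = 1"
proof (rule chi2_integer)
  show "norm2 (dotp w x) \<le> 1" unfolding dotp_def
  proof (rule norm2_sum_le)
    fix \<nu>
    have "norm2 (w $ \<nu>) * norm2 (x $ \<nu>) \<le> 2 powi m * 2 powi (- m)"
      using assms by (intro mult_mono) (auto simp: lattice2_def norm2_nonneg)
    also have "(2::real) powi m * 2 powi (- m) = 1" by (simp add: power_int_minus)
    finally show "norm2 (w $ \<nu> * x $ \<nu>) \<le> 1" by (simp add: norm2_mult)
  qed simp
qed

text \<open>Converse of duality. The witness sits in one coordinate where w is too large and is
  scaled so that the pairing is 1/2.\<close>

lemma chi2_dotp_separates:
  assumes "w \<notin> lattice2 (- m)"
  obtains h :: "Q2^'n" where "h \<in> lattice2 m" "chi2 (dotp w h) = -1"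
proof -
  obtain \<nu> where \<nu>: "norm2 (w $ \<nu>) > 2 powi m" using assms by (auto simp: lattice2_def not_le)
  then have "w $ \<nu> \<noteq> 0" using zero_less_power_int[of "2::real" m] by (auto simp del: zero_less_power_int)
  define h where "h = (\<chi> i. if i = \<nu> then inverse (2 * w $ \<nu>) else 0)"
  have "dotp w h = (\<Sum>i\<in>UNIV. if i = \<nu> then inverse 2 else 0)"
    unfolding dotp_def h_def using \<open>w $ \<nu> \<noteq> 0\<close> by (intro sum.cong) auto
  then have "dotp w h = inverse 2" by simp
  moreover have "norm2 (inverse (2 * w $ \<nu>)) \<le> 2 powi (- m)"
  proof -
    \<comment> \<open>Norms are powers of 2, so exceeding 2^m means reaching 2^(m+1). This pays for
      the extra 2 in the denominator.\<close>
    have "\<not> norm2 (w $ \<nu>) < 2 powi (m + 1)"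
      using \<nu> norm2_less_powi_iff[of "w $ \<nu>" "m + 1"] by simp
    then have "2 * 2 powi m \<le> norm2 (w $ \<nu>)" by (simp add: power_int_add_1)
    then have "inverse (norm2 (w $ \<nu>)) \<le> inverse (2 * 2 powi m)" by (intro le_imp_inverse_le) auto
    then show ?thesis by (simp add: norm2_mult norm2_inverse norm2_divide power_int_minus)
  qed
  then have "h \<in> lattice2 m" by (auto simp: lattice2_def h_def)
  ultimately show ?thesis using that chi2_half by metis
qed

lemma continuous_lattice2_periodic:
  fixes f :: "Q2^'n \<Rightarrow> complex"
  assumes "\<And>x y. x - y \<in> lattice2 m \<Longrightarrow> f x = f y"
  shows "continuous_on UNIV f"
proof -
  have "open (f -` B)" for B
  proof -
    have "f -` B = (\<Union>x\<in>f -` B. coset2 m x)"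
    proof (intro set_eqI iffI)
      fix y assume "y \<in> (\<Union>x\<in>f -` B. coset2 m x)"
      then show "y \<in> f -` B" using assms by (auto simp: coset2_def)
    next
      fix y assume "y \<in> f -` B"
      then show "y \<in> (\<Union>x\<in>f -` B. coset2 m x)" by (rule UN_I) simp
    qed
    moreover have "open (\<Union>x\<in>f -` B. coset2 m x)" by (intro open_UN ballI open_coset2)
    ultimately show ?thesis by simp
  qed
  then show ?thesis by (simp add: continuous_on_open_vimage)
qed

lemma chi2_dotp_measurable [measurable]: "(\<lambda>x. chi2 (dotp w x)) \<in> borel_measurable borel"
proof (rule borel_measurable_continuous_onI)
  obtain i :: nat where i: "w \<in> lattice2 (- int i)" using UN_lattice2 by blast
  show "continuous_on UNIV (\<lambda>x. chi2 (dotp w x))"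
  proof (rule continuous_lattice2_periodic)
    fix x y :: "Q2^'a" assume "x - y \<in> lattice2 (int i)"
    from chi2_dotp_dual[OF i this] show "chi2 (dotp w x) = chi2 (dotp w y)"
      using chi2_add[of "dotp w (x - y)" "dotp w y"] by (simp add: dotp_diff_right)
  qed
qed

section \<open>Waves, with level m, centre u and frequency w, and their transforms\<close>

definition wave :: "int \<Rightarrow> Q2^'n \<Rightarrow> Q2^'n \<Rightarrow> Q2^'n \<Rightarrow> complex" where
  "wave m u w x = indicator (coset2 m u) x * chi2 (dotp w x)"

lemma wave_measurable [measurable]: "wave m u w \<in> borel_measurable borel"
  unfolding wave_def[abs_def] by measurable

lemma chi2_mult_wave: "chi2 (dotp \<xi> x) * wave m u w x = wave m u (\<xi> + w) x"
  by (simp add: wave_def dotp_add_left chi2_add)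

lemma integrable_wave: "integrable haar (wave m u w)"
proof (rule integrableI_bounded_set[where A = "coset2 m u" and B = 1])
  show "wave m u w \<in> borel_measurable haar"
    using wave_measurable by simp
qed (auto simp: wave_def emeasure_coset2_finite norm_mult)

text \<open>For w in the dual lattice the character is constant on the coset. Otherwise a shift by a
  separating h preserves the coset and flips the sign, so the integral equals its own
  negative.\<close>

lemma integral_wave:
  fixes w :: "Q2^'n"
  shows "(LINT x|haar. wave m u w x) =
    (if w \<in> lattice2 (- m) then vol2 TYPE('n) m * chi2 (dotp w u) else 0)"
proof (cases "w \<in> lattice2 (- m)")
  case True
  have "wave m u w x = indicator (coset2 m u) x *\<^sub>R chi2 (dotp w u)" for x
  proof (cases "x \<in> coset2 m u")
    case x: True
    then have "chi2 (dotp w (x - u)) = 1" by (intro chi2_dotp_dual[OF True]) (simp add: coset2_def)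
    then show ?thesis
      using x chi2_add[of "dotp w (x - u)" "dotp w u"] by (simp add: wave_def dotp_diff_right)
  qed (simp add: wave_def)
  then have "(LINT x|haar. wave m u w x) = (LINT x|haar. indicator (coset2 m u) x *\<^sub>R chi2 (dotp w u))"
    by presburger
  also have "\<dots> = measure haar (coset2 m u) *\<^sub>R chi2 (dotp w u)"
    by (subst integral_scaleR_left) (auto intro: integrable_real_indicator emeasure_coset2_finite)
  finally show ?thesis using True by (simp add: measure_haar_coset2 scaleR_conv_of_real)
next
  case False
  then obtain h where h: "h \<in> lattice2 m" "chi2 (dotp w h) = -1" by (rule chi2_dotp_separates)
  have "x + h \<in> coset2 m u \<longleftrightarrow> x \<in> coset2 m u" for x
    using lattice2_add[OF _ h(1), of "x - u"] lattice2_diff[OF _ h(1), of "x + h - u"]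
    by (auto simp: coset2_def algebra_simps)
  then have "wave m u w (x + h) = - wave m u w x" for x
    by (simp add: wave_def dotp_add_right chi2_add h(2) indicator_def)
  then have "(LINT x|haar. wave m u w x) = (LINT x|haar. - wave m u w x)"
    using haar_integral_translate[OF wave_measurable, of m u w h] by simp
  then show ?thesis using False by simp
qed

text \<open>Centre and frequency trade places, up to sign, and the level passes to its dual. This
  closed form reduces inversion to bookkeeping.\<close>

lemma fourier_wave:
  fixes w :: "Q2^'n"
  shows "fourier (wave m u w) \<xi> = vol2 TYPE('n) m * chi2 (dotp w u) * wave (- m) (- w) u \<xi>"
  unfolding fourier_def chi2_mult_wave integral_wave
  by (auto simp: wave_def coset2_def dotp_add_left chi2_add dotp_commute[of u] indicator_def)

lemma inv_fourier_wave:
  fixes w :: "Q2^'n"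
  shows "inv_fourier (wave m u w) x = vol2 TYPE('n) m * chi2 (dotp w u) * wave (- m) w (- u) x"
  unfolding inv_fourier_def chi2_mult_wave integral_wave
  using lattice2_diff_commute[of x w "- m"]
  by (auto simp: wave_def coset2_def dotp_diff_left chi2_diff dotp_commute[of u] indicator_def)

text \<open>The index type is fixed because an existential cannot range over types;
  \<open>wave_sumI\<close> admits any finite index set.\<close>

definition wave_sum :: "(Q2^'n \<Rightarrow> complex) \<Rightarrow> bool" where
  "wave_sum f \<longleftrightarrow> (\<exists>(I :: nat set) d m u w. finite I \<and> f = (\<lambda>x. \<Sum>i\<in>I. d i * wave (m i) (u i) (w i) x))"

lemma wave_sumI:
  assumes "finite I" "f = (\<lambda>x. \<Sum>i\<in>I. d i * wave (m i) (u i) (w i) x)"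
  shows "wave_sum f"
proof -
  obtain h :: "_ \<Rightarrow> nat" where "inj_on h I" using assms(1) finite_imp_inj_to_nat_seg by blast
  then have "f = (\<lambda>x. \<Sum>i\<in>h ` I. d (inv_into I h i) *
      wave (m (inv_into I h i)) (u (inv_into I h i)) (w (inv_into I h i)) x)"
    unfolding assms(2) by (simp add: sum.reindex)
  moreover have "finite (h ` I)" using assms(1) by simp
  ultimately show ?thesis unfolding wave_sum_def by (intro exI conjI)
qed

lemma fourier_sum_wave:
  "fourier (\<lambda>x. \<Sum>i\<in>I. d i * wave (m i) (u i) (w i) x) \<xi> = (\<Sum>i\<in>I. d i * fourier (wave (m i) (u i) (w i)) \<xi>)"
  unfolding fourier_def sum_distrib_left mult.left_commute[of _ "d _"] chi2_mult_wave
  by (simp add: integrable_wave)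

lemma inv_fourier_sum_wave:
  "inv_fourier (\<lambda>x. \<Sum>i\<in>I. d i * wave (m i) (u i) (w i) x) \<xi> =
    (\<Sum>i\<in>I. d i * inv_fourier (wave (m i) (u i) (w i)) \<xi>)"
  unfolding inv_fourier_def sum_distrib_left mult.left_commute[of _ "d _"] chi2_mult_wave
  by (simp add: integrable_wave)

text \<open>Both transforms in succession restore level, centre and frequency of each wave; the
  volumes of dual lattices multiply to 1 and the two phases cancel.\<close>

lemma wave_sum_inversion:
  fixes f :: "Q2^'n \<Rightarrow> complex"
  assumes "wave_sum f"
  shows "inv_fourier (fourier f) = f" "fourier (inv_fourier f) = f"
proof -
  obtain I :: "nat set" and d m u w where f: "f = (\<lambda>x. \<Sum>i\<in>I. d i * wave (m i) (u i) (w i) x)"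
    using assms unfolding wave_sum_def by blast
  let ?v = "\<lambda>k. complex_of_real (vol2 TYPE('n) k)"
  have v: "?v k * ?v (- k) = 1" for k by (simp flip: of_real_mult)
  have 1: "d i * (?v (m i) * chi2 (dotp (w i) (u i))) * (?v (- m i) * chi2 (- dotp (w i) (u i))) = d i" for i
    using v[of "m i"] by (simp add: chi2_minus field_simps)
  have F: "fourier f = (\<lambda>\<xi>. \<Sum>i\<in>I. (d i * (?v (m i) * chi2 (dotp (w i) (u i)))) * wave (- m i) (- w i) (u i) \<xi>)"
    unfolding f by (simp add: fun_eq_iff fourier_sum_wave fourier_wave mult_ac)
  have "inv_fourier (fourier f) = (\<lambda>x. \<Sum>i\<in>I. (d i * (?v (m i) * chi2 (dotp (w i) (u i)))) *
      (?v (- m i) * chi2 (- dotp (w i) (u i))) * wave (m i) (u i) (w i) x)"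
    unfolding F inv_fourier_sum_wave inv_fourier_wave
    by (simp add: dotp_commute[of "u _"] mult.assoc)
  then show "inv_fourier (fourier f) = f" by (simp only: 1 f)
  have F: "inv_fourier f = (\<lambda>\<xi>. \<Sum>i\<in>I. (d i * (?v (m i) * chi2 (dotp (w i) (u i)))) * wave (- m i) (w i) (- u i) \<xi>)"
    unfolding f by (simp add: fun_eq_iff inv_fourier_sum_wave inv_fourier_wave mult_ac)
  have "fourier (inv_fourier f) = (\<lambda>x. \<Sum>i\<in>I. (d i * (?v (m i) * chi2 (dotp (w i) (u i)))) *
      (?v (- m i) * chi2 (- dotp (w i) (u i))) * wave (m i) (u i) (w i) x)"
    unfolding F fourier_sum_wave fourier_wave
    by (simp add: dotp_commute[of "u _"] mult.assoc)
  then show "fourier (inv_fourier f) = f" by (simp only: 1 f)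
qed

section \<open>Test functions and wavelet coefficients\<close>

lemma wave_locally_constant: "\<forall>\<^sub>F y in nhds x. wave m u w y = wave m u w (x :: Q2^'n)"
proof -
  obtain i :: nat where i: "w \<in> lattice2 (- int i)" using UN_lattice2 by blast
  \<comment> \<open>Fine enough both for the indicator and for the character.\<close>
  define k where "k = max m (int i)"
  have "wave m u w y = wave m u w x" if "y \<in> coset2 k x" for y
  proof -
    have yx: "y - x \<in> lattice2 k" using that by (simp add: coset2_def)
    have "w \<in> lattice2 (- k)" by (rule lattice2_antimono[OF _ i]) (simp add: k_def)
    then have "chi2 (dotp w (y - x)) = 1" using yx by (rule chi2_dotp_dual)
    then have "chi2 (dotp w y) = chi2 (dotp w x)"
      using chi2_add[of "dotp w (y - x)" "dotp w x"] by (simp add: dotp_diff_right)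
    moreover have "y - x \<in> lattice2 m" using yx by (rule lattice2_antimono[rotated]) (simp add: k_def)
    then have "y \<in> coset2 m u \<longleftrightarrow> x \<in> coset2 m u"
      using lattice2_trans[of y x m u] lattice2_trans[of x y m u]
      by (auto simp: coset2_def lattice2_diff_commute[of x y])
    ultimately show ?thesis by (simp add: wave_def indicator_def)
  qed
  then show ?thesis
    using eventually_nhds_in_open[OF open_coset2 coset2_self] by (rule eventually_mono[rotated])
qed

lemma wave_sum_locally_constant:
  assumes "wave_sum f"
  shows "\<forall>\<^sub>F y in nhds x. f y = f x"
proof -
  obtain I :: "nat set" and d m u w where I: "finite I"
    and f: "f = (\<lambda>x. \<Sum>i\<in>I. d i * wave (m i) (u i) (w i) x)"
    using assms unfolding wave_sum_def by blast
  have "\<forall>\<^sub>F y in nhds x. \<forall>i\<in>I. wave (m i) (u i) (w i) y = wave (m i) (u i) (w i) x"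
    using I by (intro eventually_ball_finite ballI wave_locally_constant)
  then show ?thesis unfolding f by eventually_elim simp
qed

lemma wave_sum_test_function:
  assumes "wave_sum f"
  shows "f \<in> test_functions"
proof -
  obtain I :: "nat set" and d m u w where I: "finite I"
    and f: "f = (\<lambda>x. \<Sum>i\<in>I. d i * wave (m i) (u i) (w i) x)"
    using assms unfolding wave_sum_def by blast
  have "locally_constant_on UNIV f" unfolding locally_constant_on_def
    using wave_sum_locally_constant[OF assms] filter_leD[OF at_within_le_nhds] by blast
  moreover have "compact (closure {x. f x \<noteq> 0})"
  proof -
    let ?C = "\<Union>i\<in>I. coset2 (m i) (u i)"
    have C: "compact ?C" using I by (intro compact_UN compact_coset2) auto
    have "f x = 0" if "x \<notin> ?C" for x
      using that unfolding f by (auto simp: wave_def intro!: sum.neutral)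
    then have "closure {x. f x \<noteq> 0} \<subseteq> ?C"
      using compact_imp_closed[OF C] by (intro closure_minimal) auto
    then have "?C \<inter> closure {x. f x \<noteq> 0} = closure {x. f x \<noteq> 0}" by (rule Int_absorb1)
    then show ?thesis using compact_Int_closed[OF C closed_closure[of "{x. f x \<noteq> 0}"]] by (simp only:)
  qed
  ultimately show ?thesis by (simp add: test_functions_def)
qed

text \<open>Compactness replaces the point-dependent level of constancy by a uniform one; the
  function is then a finite sum of indicators, that is, of waves of frequency 0.\<close>

lemma wave_sum_of_locally_constant:
  fixes g :: "Q2^'n \<Rightarrow> complex"
  assumes loc: "\<And>\<xi>. \<xi> \<in> coset2 j v \<Longrightarrow> \<forall>\<^sub>F \<eta> in nhds \<xi>. g \<eta> = g \<xi>"
    and zero: "\<And>\<xi>. \<xi> \<notin> coset2 j v \<Longrightarrow> g \<xi> = 0"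
  shows "wave_sum g"
proof -
  let ?S = "coset2 j v"
  have "\<exists>m. \<forall>\<eta>\<in>coset2 m \<xi>. g \<eta> = g \<xi>" if "\<xi> \<in> ?S" for \<xi>
    using loc[OF that] coset2_nhds_base[of _ \<xi>] unfolding eventually_nhds by (metis subsetD)
  then obtain m where m: "\<And>\<xi> \<eta>. \<xi> \<in> ?S \<Longrightarrow> \<eta> \<in> coset2 (m \<xi>) \<xi> \<Longrightarrow> g \<eta> = g \<xi>" by metis
  obtain F where F: "F \<subseteq> ?S" "finite F" "?S \<subseteq> (\<Union>\<xi>\<in>F. coset2 (m \<xi>) \<xi>)"
  proof (rule compactE_image[OF compact_coset2[of j v], of ?S "\<lambda>\<xi>. coset2 (m \<xi>) \<xi>"])
    show "?S \<subseteq> (\<Union>\<xi>\<in>?S. coset2 (m \<xi>) \<xi>)" by (auto intro: coset2_self)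
  qed (auto simp: open_coset2)
  \<comment> \<open>A coset of the finest level M stays inside any covering coset it meets;
    including j keeps it inside the support region as well.\<close>
  define M where "M = Max (insert j (m ` F))"
  have jM: "j \<le> M" and mM: "\<And>\<xi>. \<xi> \<in> F \<Longrightarrow> m \<xi> \<le> M" using F(2) by (auto simp: M_def)
  have const: "g \<eta> = g \<xi>" if \<xi>: "\<xi> \<in> ?S" and \<eta>: "\<eta> \<in> coset2 M \<xi>" for \<xi> \<eta>
  proof -
    obtain \<zeta> where \<zeta>: "\<zeta> \<in> F" "\<xi> \<in> coset2 (m \<zeta>) \<zeta>" using F(3) \<xi> by blast
    have "\<eta> \<in> coset2 (m \<zeta>) \<xi>" using \<eta> coset2_antimono[OF mM[OF \<zeta>(1)]] by blast
    then have "\<eta> \<in> coset2 (m \<zeta>) \<zeta>" using coset2_eqI[OF \<zeta>(2)] by blast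
    then show ?thesis using m \<zeta> F(1) by (metis subsetD)
  qed
  obtain F' where F': "F' \<subseteq> ?S" "finite F'" "?S \<subseteq> (\<Union>\<xi>\<in>F'. coset2 M \<xi>)"
  proof (rule compactE_image[OF compact_coset2[of j v], of ?S "coset2 M"])
    show "?S \<subseteq> (\<Union>\<xi>\<in>?S. coset2 M \<xi>)" by (auto intro: coset2_self)
  qed (auto simp: open_coset2)
  \<comment> \<open>Distinct centres may give the same coset. One representative per coset avoids
    counting a point twice.\<close>
  obtain T where T: "T \<subseteq> F'" "inj_on (coset2 M) T" "coset2 M ` F' = coset2 M ` T"
    using subset_image_inj[of "coset2 M ` F'" "coset2 M" F', THEN iffD1, OF order_refl] by (elim exE conjE)
  have finT: "finite T" using T(1) F'(2) finite_subset by blast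
  have "g \<xi> = (\<Sum>u\<in>T. g u * wave M u 0 \<xi>)" for \<xi>
  proof (cases "\<xi> \<in> ?S")
    case True
    then have "coset2 M \<xi> \<in> coset2 M ` T"
      using F'(3) coset2_eqI[of \<xi> M] unfolding T(3)[symmetric] by blast
    then obtain t where t: "t \<in> T" "coset2 M \<xi> = coset2 M t" by blast
    have "\<xi> \<in> coset2 M u \<longleftrightarrow> u = t" if "u \<in> T" for u
      using t T(2) that coset2_eqI[of \<xi> M u] coset2_self[of \<xi> M] unfolding inj_on_def by metis
    then have "(\<Sum>u\<in>T. g u * wave M u 0 \<xi>) = (\<Sum>u\<in>T. if u = t then g t else 0)"
      by (intro sum.cong) (auto simp: wave_def)
    also have "\<dots> = g t" using t(1) finT by simp
    also have "g t = g \<xi>" using const[OF True, of t] t(2) coset2_self[of t M] by simp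
    finally show ?thesis ..
  next
    case False
    have "\<xi> \<notin> coset2 M u" if "u \<in> T" for u
    proof
      assume "\<xi> \<in> coset2 M u"
      then have "\<xi> \<in> coset2 j u" using coset2_antimono[OF jM] by blast
      moreover have "coset2 j u = ?S" using that T(1) F'(1) by (intro coset2_eqI) blast
      ultimately show False using False by simp
    qed
    then show ?thesis using zero[OF False] by (simp add: wave_def)
  qed
  then show ?thesis
    by (intro wave_sumI[OF finT, where d = g and m = "\<lambda>_. M" and u = "\<lambda>u. u" and w = "\<lambda>_. 0"] ext)
qed

text \<open>Dilation by 2^j turns level 0 into -j and frequency k_e/2 into 2^(j-1) k_e; the phase
  results from evaluating the character at x instead of x minus the centre.\<close>

lemma Psi0_eq_wave:
  "Psi0 e ((2 powi j) *s x - b) =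
    chi2 (- dotp ((2 powi (j - 1)) *s k_vec e) ((2 powi (- j)) *s b)) *
    wave (- j) ((2 powi (- j)) *s b) ((2 powi (j - 1)) *s k_vec e) x"
proof -
  define v where "v = (2 powi (- j)) *s b"
  have b: "b = (2 powi j) *s v" by (simp add: v_def power_int_minus vec_eq_iff)
  have y: "(2 powi j) *s x - b = (2 powi j) *s (x - v)" by (simp only: b vector_ssub_ldistrib)
  have inner: "inverse 2 * dotp (k_vec e) ((2 powi j) *s (x - v)) = dotp ((2 powi (j - 1)) *s k_vec e) (x - v)"
    unfolding dotp_scale_right dotp_scale_left by (simp add: power_int_diff field_simps)
  have Om: "Omega (vnorm2 ((2 powi j) *s (x - v))) = indicator (coset2 (- j) v) x"
  proof -
    have "vnorm2 ((2 powi j) *s (x - v)) \<le> 1 \<longleftrightarrow> x \<in> coset2 (- j) v"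
      using lattice2_scale[of j "x - v" 0] unfolding Z2n_eq_lattice2[symmetric]
      by (simp add: Z2n_def coset2_def)
    then show ?thesis by (simp add: Omega_def vnorm2_nonneg indicator_def)
  qed
  show ?thesis
    unfolding y Psi0_def inner Om v_def[symmetric] wave_def dotp_diff_right chi2_diff by simp
qed

section \<open>Discrete Fourier transform of admissible coefficients\<close>

lemma sum_roots_of_unity:
  fixes t :: int
  assumes "n > 0"
  shows "(\<Sum>r<n. exp (2 * complex_of_real pi * \<i> * (of_int t / of_nat n) * of_nat r)) =
    (if int n dvd t then of_nat n else 0)"
proof -
  define x where "x = exp (2 * complex_of_real pi * \<i> * (of_int t / of_nat n))"
  have sum: "(\<Sum>r<n. exp (2 * complex_of_real pi * \<i> * (of_int t / of_nat n) * of_nat r)) = (\<Sum>r<n. x ^ r)"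
    unfolding x_def by (intro sum.cong) (simp_all add: exp_of_nat_mult[symmetric] mult_ac)
  have "x = 1 \<longleftrightarrow> (\<exists>k::int. real_of_int t / real n = real_of_int k)"
  proof -
    have re: "Re (2 * complex_of_real pi * \<i> * (of_int t / of_nat n)) = 0"
      and im: "Im (2 * complex_of_real pi * \<i> * (of_int t / of_nat n)) = 2 * pi * (real_of_int t / real n)"
      by (simp_all add: Re_divide_of_nat Im_divide_of_nat)
    have cancel: "2 * pi * q = real_of_int (2 * k) * pi \<longleftrightarrow> q = real_of_int k" for q k by auto
    show ?thesis unfolding x_def exp_eq_1 re im cancel by simp
  qed
  also have "\<dots> \<longleftrightarrow> int n dvd t"
  proof -
    have "real_of_int t / real n = real_of_int k \<longleftrightarrow> t = int n * k" for k
    proof -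
      have "real_of_int t / real n = real_of_int k \<longleftrightarrow> real_of_int t = real_of_int (int n * k)"
        using assms by (simp add: nonzero_divide_eq_eq mult.commute)
      then show ?thesis by (simp only: of_int_eq_iff)
    qed
    then show ?thesis by (auto simp: dvd_def)
  qed
  finally have x1: "x = 1 \<longleftrightarrow> int n dvd t" .
  show ?thesis
  proof (cases "x = 1")
    case False
    have "x ^ n = exp (of_int t * (2 * complex_of_real pi * \<i>))"
      using assms unfolding x_def exp_of_nat_mult[symmetric] by (simp add: field_simps)
    also have "\<dots> = 1" using exp_integer_2pi[of "of_int t"] by (simp add: mult_ac)
    finally show ?thesis using False x1 unfolding sum by (simp add: geometric_sum)
  qed (use x1 sum in auto)
qed

text \<open>A shifted discrete Fourier transform recovers one of the unimodular parameters.\<close>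

lemma admissible_dft_nonzero:
  assumes "admissible s \<alpha>" and z: "norm2 (z + inverse 2) \<le> 1"
  shows "(\<Sum>k<2 ^ s. \<alpha> 1 k * chi2 (z * (of_nat k / 2 ^ s))) \<noteq> 0"
proof (cases "s = 0")
  case True
  then show ?thesis using assms(1) by (simp add: admissible_def)
next
  case False
  define n :: nat where "n = 2 ^ s"
  have n: "n > 0" "(of_nat n :: complex) = 2 ^ s" by (simp_all add: n_def)
  obtain \<gamma> where \<gamma>: "\<And>r. r < n \<Longrightarrow> cmod (\<gamma> r) = 1"
    and \<alpha>: "\<And>k. k < n \<Longrightarrow> \<alpha> 1 k = 1 / 2 ^ s * (- 1) ^ k *
      (\<Sum>r<n. \<gamma> r * exp (- (\<i> * complex_of_real pi * (of_nat (2 * r + 1) / 2 ^ s) * of_nat k)))"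
    using assms(1) False unfolding admissible_def n_def by auto
  \<comment> \<open>Only z modulo 2^s matters below, so z may be replaced by i - 1/2 = (2i -
    1)/2.\<close>
  obtain i where i: "i < n" "norm2 (z + inverse 2 - of_nat i) \<le> 1 / 2 ^ s"
    using Q2_integer_residue_power[OF z] unfolding n_def by blast
  have chi: "chi2 (z * (of_nat k / 2 ^ s)) =
      exp (2 * complex_of_real pi * \<i> * (of_int ((2 * int i - 1) * int k) / 2 ^ (s + 1)))" for k
  proof (rule chi2_eq_exp_dyadic)
    have "z * (of_nat k / 2 ^ s) - of_rat (of_int ((2 * int i - 1) * int k) / 2 ^ (s + 1)) =
        (z + inverse 2 - of_nat i) / 2 ^ s * of_nat k"
      by (simp add: of_rat_divide of_rat_power of_rat_mult of_rat_diff field_simps)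
    moreover have "norm2 ((z + inverse 2 - of_nat i) / 2 ^ s * of_nat k) \<le> 1 * 1"
      unfolding norm2_mult
    proof (intro mult_mono)
      show "norm2 ((z + inverse 2 - of_nat i) / 2 ^ s) \<le> 1"
        using i(2) by (simp only: norm2_divide norm2_power norm2_2) (simp add: field_simps power_one_over)
    qed (auto simp: norm2_of_nat_le_1 norm2_nonneg)
    ultimately show "norm2 (z * (of_nat k / 2 ^ s) -
        of_rat (of_int ((2 * int i - 1) * int k) / 2 ^ (s + 1))) \<le> 1" by simp
  qed
  \<comment> \<open>Exponents counted in units of 2 pi i k / 2^s: the sign (-1)^k gives 2^(s-1), the
    coefficient gives -(r + 1/2), and z gives i - 1/2. The two halves add up to the -1.\<close>
  define t :: "nat \<Rightarrow> int" where "t r = int i - 1 - int r + 2 ^ (s - 1)" for r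
  have half: "(2::complex) ^ s = 2 * 2 ^ (s - 1)" using False by (cases s) auto
  have summand: "1 / 2 ^ s * (- 1) ^ k * (\<gamma> r * exp (- (\<i> * complex_of_real pi * (of_nat (2 * r + 1) / 2 ^ s) * of_nat k))) *
      chi2 (z * (of_nat k / 2 ^ s)) =
      \<gamma> r / of_nat n * exp (2 * complex_of_real pi * \<i> * (of_int (t r) / of_nat n) * of_nat k)" for k r
  proof -
    have "(- 1) ^ k = exp (of_nat k * (\<i> * complex_of_real pi))"
      by (simp add: exp_of_nat_mult exp_pi_i')
    then have "(- 1) ^ k * exp (- (\<i> * complex_of_real pi * (of_nat (2 * r + 1) / 2 ^ s) * of_nat k)) *
        chi2 (z * (of_nat k / 2 ^ s)) =
        exp (of_nat k * (\<i> * complex_of_real pi) + - (\<i> * complex_of_real pi * (of_nat (2 * r + 1) / 2 ^ s) * of_nat k)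
          + 2 * complex_of_real pi * \<i> * (of_int ((2 * int i - 1) * int k) / 2 ^ (s + 1)))"
      unfolding chi exp_add by simp
    also have "\<dots> = exp (2 * complex_of_real pi * \<i> * (of_int (t r) / of_nat n) * of_nat k)"
      by (rule arg_cong[of _ _ exp]) (simp add: t_def n half field_simps)
    finally have E: "(- 1) ^ k * exp (- (\<i> * complex_of_real pi * (of_nat (2 * r + 1) / 2 ^ s) * of_nat k)) *
        chi2 (z * (of_nat k / 2 ^ s)) = exp (2 * complex_of_real pi * \<i> * (of_int (t r) / of_nat n) * of_nat k)" .
    have assoc: "1 / 2 ^ s * A * (\<gamma> r * B) * C = \<gamma> r / of_nat n * (A * B * C)" for A B C
      by (simp add: n(2))
    show ?thesis unfolding assoc E ..
  qed
  have "(\<Sum>k<n. \<alpha> 1 k * chi2 (z * (of_nat k / 2 ^ s))) =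
      (\<Sum>k<n. \<Sum>r<n. \<gamma> r / of_nat n * exp (2 * complex_of_real pi * \<i> * (of_int (t r) / of_nat n) * of_nat k))"
    unfolding summand[symmetric]
  proof (intro sum.cong refl)
    fix k assume "k \<in> {..<n}"
    then have "k < n" by simp
    show "\<alpha> 1 k * chi2 (z * (of_nat k / 2 ^ s)) = (\<Sum>r<n. 1 / 2 ^ s * (- 1) ^ k *
        (\<gamma> r * exp (- (\<i> * complex_of_real pi * (of_nat (2 * r + 1) / 2 ^ s) * of_nat k))) *
        chi2 (z * (of_nat k / 2 ^ s)))"
      unfolding \<alpha>[OF \<open>k < n\<close>] sum_distrib_left sum_distrib_right ..
  qed
  also have "\<dots> = (\<Sum>r<n. \<gamma> r / of_nat n * (if int n dvd t r then of_nat n else 0))"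
    by (subst sum.swap) (simp only: sum_distrib_left[symmetric] sum_roots_of_unity[OF n(1)])
  \<comment> \<open>Orthogonality of roots of unity leaves exactly one residue r, whose parameter
    has modulus 1.\<close>
  also have "\<dots> = (\<Sum>r<n. if r = nat ((int i - 1 + 2 ^ (s - 1)) mod int n) then \<gamma> r else 0)"
  proof (intro sum.cong refl)
    fix r assume "r \<in> {..<n}"
    then have r: "int r mod int n = int r" by simp
    have "int n dvd t r \<longleftrightarrow> (int i - 1 + 2 ^ (s - 1)) mod int n = int r mod int n"
      unfolding mod_eq_dvd_iff t_def by (simp add: algebra_simps)
    also have "\<dots> \<longleftrightarrow> r = nat ((int i - 1 + 2 ^ (s - 1)) mod int n)"
      using n(1) unfolding r by auto
    finally show "\<gamma> r / of_nat n * (if int n dvd t r then of_nat n else 0) =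
        (if r = nat ((int i - 1 + 2 ^ (s - 1)) mod int n) then \<gamma> r else 0)" using n(1) by simp
  qed
  also have "\<dots> = \<gamma> (nat ((int i - 1 + 2 ^ (s - 1)) mod int n))"
    using n(1) by (subst sum.delta) (auto simp: nat_less_iff)
  also have "\<dots> \<noteq> 0"
    using \<gamma>[of "nat ((int i - 1 + 2 ^ (s - 1)) mod int n)"] n(1) by (auto simp: nat_less_iff)
  finally show ?thesis unfolding n_def by simp
qed

section \<open>The wavelets\<close>

definition half_freq :: "int \<Rightarrow> 'n set \<Rightarrow> Q2^'n" where
  "half_freq j e = (2 powi (j - 1)) *s k_vec e"

text \<open>The point where the argument of \<open>Psi0\<close> vanishes in the summand r, hence the
  centre of its wave.\<close>

definition Psi_node :: "('n \<Rightarrow> nat) \<Rightarrow> 'n set \<Rightarrow> int \<Rightarrow> Q2^'n \<Rightarrow> ('n \<Rightarrow> nat) \<Rightarrow> Q2^'n" where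
  "Psi_node s e j a r = (2 powi (- j)) *s (a + (\<chi> \<nu>. of_nat (r \<nu>) / 2 ^ s \<nu> * of_nat (k_idx e \<nu>)))"

lemma half_freq_scale: "half_freq j e = (2 powi j) *s (inverse 2 *s k_vec e)"
  by (simp add: half_freq_def power_int_diff vec_eq_iff)

lemma Psi_eq_wave_sum:
  "Psi s \<alpha> e j a = (\<lambda>x. \<Sum>r\<in>(\<Pi>\<^sub>E \<nu>\<in>UNIV. {..<2 ^ s \<nu>}).
    (complex_of_real (2 powr (- (real CARD('n) * real_of_int j / 2))) * (\<Prod>\<nu>\<in>UNIV. \<alpha> \<nu> (k_idx e \<nu>) (r \<nu>)) *
      chi2 (- dotp (half_freq j e) (Psi_node s e j a r))) * wave (- j) (Psi_node s e j a r) (half_freq j e) (x :: Q2^'n))"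
  unfolding Psi_def[abs_def] diff_diff_eq Psi0_eq_wave half_freq_def[symmetric] Psi_node_def[symmetric]
  by (simp add: sum_distrib_left mult.assoc)

lemma wave_sum_Psi: "wave_sum (Psi s \<alpha> e j a)"
  by (rule wave_sumI[OF _ Psi_eq_wave_sum]) (intro finite_PiE, auto)

definition Psi_symbol :: "('n \<Rightarrow> nat) \<Rightarrow> ('n \<Rightarrow> nat \<Rightarrow> nat \<Rightarrow> complex) \<Rightarrow> 'n set \<Rightarrow> int \<Rightarrow> Q2^'n \<Rightarrow> Q2^'n \<Rightarrow> complex" where
  "Psi_symbol s \<alpha> e j a \<xi> = (\<Sum>r\<in>(\<Pi>\<^sub>E \<nu>\<in>UNIV. {..<2 ^ s \<nu>}).
    (\<Prod>\<nu>\<in>UNIV. \<alpha> \<nu> (k_idx e \<nu>) (r \<nu>)) * chi2 (dotp (Psi_node s e j a r) \<xi>))"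

text \<open>All summands share level and frequency, so their transforms share one support. The phase
  of each wave cancels against the one created by its transform.\<close>

lemma fourier_Psi:
  "fourier (Psi s \<alpha> e j a) \<xi> =
    complex_of_real (2 powr (- (real CARD('n) * real_of_int j / 2)) * vol2 TYPE('n) (- j)) *
    indicator (coset2 j (- half_freq j e)) \<xi> * Psi_symbol s \<alpha> e j a (\<xi> :: Q2^'n)"
proof -
  have cancel: "d * b * chi2 (- t) * (v * chi2 t * w) = d * v * (b * w)" for d b v w t
    by (simp add: chi2_minus)
  show ?thesis
    unfolding Psi_eq_wave_sum fourier_sum_wave fourier_wave minus_minus cancel
    by (simp add: wave_def Psi_symbol_def sum_distrib_left mult_ac)
qed

text \<open>The character of a sum is a product over coordinates, so the sum over multi-indices
  factors into one-dimensional sums, none of which vanishes.\<close>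

lemma Psi_symbol_nonzero:
  fixes \<xi> :: "Q2^'n"
  assumes adm: "\<And>\<nu>. admissible (s \<nu>) (\<alpha> \<nu>)" and \<xi>: "\<xi> \<in> coset2 j (- half_freq j e)"
  shows "Psi_symbol s \<alpha> e j a \<xi> \<noteq> 0"
proof -
  \<comment> \<open>Rescaling moves S to -k_e/2 plus integers, where
    \<open>admissible_dft_nonzero\<close> applies in the coordinates belonging to
    \<open>e\<close>.\<close>
  define \<zeta> where "\<zeta> = (2 powi (- j)) *s \<xi>"
  let ?k = "\<lambda>\<nu>. of_nat (k_idx e \<nu>) :: Q2"
  have "(2 powi j) *s (\<zeta> + inverse 2 *s k_vec e) = \<xi> - (- half_freq j e)"
    by (simp add: vec_eq_iff \<zeta>_def half_freq_scale power_int_minus algebra_simps)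
  then have "(2 powi j) *s (\<zeta> + inverse 2 *s k_vec e) \<in> lattice2 j" using \<xi> by (simp add: coset2_def)
  then have "\<zeta> + inverse 2 *s k_vec e \<in> lattice2 0" unfolding lattice2_scale by simp
  then have \<zeta>: "norm2 (\<zeta> $ \<nu> + inverse 2) \<le> 1" if "\<nu> \<in> e" for \<nu>
    using that by (force simp: lattice2_def dest: spec[of _ \<nu>])
  have chi: "chi2 (dotp (Psi_node s e j a r) \<xi>) =
      chi2 (dotp a \<zeta>) * (\<Prod>\<nu>\<in>UNIV. chi2 (\<zeta> $ \<nu> * (of_nat (r \<nu>) / 2 ^ s \<nu> * ?k \<nu>)))" for r
  proof -
    have "dotp (Psi_node s e j a r) \<xi> = dotp (a + (\<chi> \<nu>. of_nat (r \<nu>) / 2 ^ s \<nu> * ?k \<nu>)) \<zeta>"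
      unfolding Psi_node_def \<zeta>_def dotp_scale_left dotp_scale_right ..
    also have "\<dots> = dotp a \<zeta> + (\<Sum>\<nu>\<in>UNIV. \<zeta> $ \<nu> * (of_nat (r \<nu>) / 2 ^ s \<nu> * ?k \<nu>))"
      unfolding dotp_add_left by (simp add: dotp_def mult.commute)
    finally show ?thesis by (simp only: chi2_add chi2_sum)
  qed
  have "Psi_symbol s \<alpha> e j a \<xi> = chi2 (dotp a \<zeta>) * (\<Sum>r\<in>(\<Pi>\<^sub>E \<nu>\<in>UNIV. {..<2 ^ s \<nu>}).
      \<Prod>\<nu>\<in>UNIV. \<alpha> \<nu> (k_idx e \<nu>) (r \<nu>) * chi2 (\<zeta> $ \<nu> * (of_nat (r \<nu>) / 2 ^ s \<nu> * ?k \<nu>)))"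
    unfolding Psi_symbol_def chi by (simp add: sum_distrib_left prod.distrib mult_ac)
  also have "(\<Sum>r\<in>(\<Pi>\<^sub>E \<nu>\<in>UNIV. {..<2 ^ s \<nu>}).
      \<Prod>\<nu>\<in>UNIV. \<alpha> \<nu> (k_idx e \<nu>) (r \<nu>) * chi2 (\<zeta> $ \<nu> * (of_nat (r \<nu>) / 2 ^ s \<nu> * ?k \<nu>))) =
    (\<Prod>\<nu>\<in>UNIV. \<Sum>q<2 ^ s \<nu>. \<alpha> \<nu> (k_idx e \<nu>) q * chi2 (\<zeta> $ \<nu> * (of_nat q / 2 ^ s \<nu> * ?k \<nu>)))"
    by (rule prod_sum_PiE[symmetric]) auto
  finally have eq: "Psi_symbol s \<alpha> e j a \<xi> = chi2 (dotp a \<zeta>) *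
    (\<Prod>\<nu>\<in>UNIV. \<Sum>q<2 ^ s \<nu>. \<alpha> \<nu> (k_idx e \<nu>) q * chi2 (\<zeta> $ \<nu> * (of_nat q / 2 ^ s \<nu> * ?k \<nu>)))" .
  have "(\<Sum>q<2 ^ s \<nu>. \<alpha> \<nu> (k_idx e \<nu>) q * chi2 (\<zeta> $ \<nu> * (of_nat q / 2 ^ s \<nu> * ?k \<nu>))) \<noteq> 0" for \<nu>
  proof (cases "\<nu> \<in> e")
    case True
    then show ?thesis using admissible_dft_nonzero[OF adm \<zeta>[OF True], of \<nu>] by (simp add: k_idx_def)
  next
    case False
    \<comment> \<open>Outside \<open>e\<close> the character is trivial and the coefficients form a
      delta, so the factor is 1.\<close>
    have "(\<Sum>q<2 ^ s \<nu>. \<alpha> \<nu> 0 q) = (\<Sum>q<(2::nat) ^ s \<nu>. if q = 0 then 1 else 0)"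
      using adm[of \<nu>] by (intro sum.cong) (auto simp: admissible_def)
    then show ?thesis using False by (simp add: k_idx_def)
  qed
  then show ?thesis unfolding eq by simp
qed

text \<open>A coordinate in \<open>e\<close> of k_e/2 has norm 2, so k_e/2 is no integer vector.
  Hence the transform of the wavelet vanishes at 0, and the symbol is only evaluated where it is
  locally constant.\<close>

lemma zero_notin_coset2_half_freq:
  assumes "e \<noteq> {}"
  shows "0 \<notin> coset2 j (- half_freq j e)"
proof
  assume "0 \<in> coset2 j (- half_freq j e)"
  then have "k_vec e \<in> (lattice2 1 :: (Q2^'a) set)"
    by (simp add: coset2_def half_freq_def lattice2_scale)
  moreover obtain \<nu> where "\<nu> \<in> e" using assms by blast
  ultimately show False by (force simp: lattice2_def power_int_minus dest: spec[of _ \<nu>])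
qed

lemma Psi_in_lizorkin:
  assumes "e \<noteq> {}"
  shows "Psi s \<alpha> e j a \<in> lizorkin"
proof -
  have "(LINT x|haar. Psi s \<alpha> e j a x) = fourier (Psi s \<alpha> e j a) 0"
    by (simp add: fourier_def)
  also have "\<dots> = 0" unfolding fourier_Psi using zero_notin_coset2_half_freq[OF assms] by simp
  finally show ?thesis
    using wave_sum_test_function[OF wave_sum_Psi] by (simp add: lizorkin_def)
qed

lemma inv_fourier_scale: "inv_fourier (\<lambda>\<xi>. c * f \<xi>) x = c * inv_fourier f x"
  unfolding inv_fourier_def by (simp add: mult.left_commute[of _ c])

lemma fourier_scale: "fourier (\<lambda>\<xi>. c * f \<xi>) x = c * fourier f x"
  unfolding fourier_def by (simp add: mult.left_commute[of _ c])

lemma fourier_Psi_nonzero: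
  assumes "\<And>\<nu>. admissible (s \<nu>) (\<alpha> \<nu>)" "\<xi> \<in> coset2 j (- half_freq j e)"
  shows "fourier (Psi s \<alpha> e j a) \<xi> \<noteq> 0"
  unfolding fourier_Psi using Psi_symbol_nonzero[OF assms, where a = a] assms(2) vol2_pos[where 'n = 'a, of "- j"]
  by simp

text \<open>Off S the transform vanishes, so multiplication by the symbol is multiplication by
  \<open>c\<close>.\<close>

lemma pseudo_diff_Psi:
  assumes const: "\<And>\<xi>. \<xi> \<in> coset2 j (- half_freq j e) \<Longrightarrow> \<A> \<xi> = c" and "e \<noteq> {}"
  shows "pseudo_diff \<A> (Psi s \<alpha> e j a) = (\<lambda>x. c * Psi s \<alpha> e j a x)"
proof -
  have "(if \<xi> = 0 then 0 else \<A> \<xi> * fourier (Psi s \<alpha> e j a) \<xi>) = c * fourier (Psi s \<alpha> e j a) \<xi>" for \<xi>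
    using const[of \<xi>] zero_notin_coset2_half_freq[OF assms(2), of j]
    by (cases "\<xi> \<in> coset2 j (- half_freq j e)") (auto simp: fourier_Psi)
  then have "pseudo_diff \<A> (Psi s \<alpha> e j a) = inv_fourier (\<lambda>\<xi>. c * fourier (Psi s \<alpha> e j a) \<xi>)"
    unfolding pseudo_diff_def by simp
  then show ?thesis by (simp add: fun_eq_iff inv_fourier_scale wave_sum_inversion(1)[OF wave_sum_Psi])
qed

text \<open>The forward transform undoes the inverse one only on wave sums, so the main point is
  that symbol times transform is again a wave sum.\<close>

lemma pseudo_diff_Psi_eigenvalue:
  assumes loc: "locally_constant_on (- {0}) \<A>" and adm: "\<And>\<nu>. admissible (s \<nu>) (\<alpha> \<nu>)" and e: "e \<noteq> {}"
    and eigen: "pseudo_diff \<A> (Psi s \<alpha> e j a) = (\<lambda>x. c * Psi s \<alpha> e j a x)"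
    and \<xi>: "\<xi> \<in> coset2 j (- half_freq j e)"
  shows "\<A> \<xi> = c"
proof -
  let ?S = "coset2 j (- half_freq j e)"
  define G where "G = fourier (Psi s \<alpha> e j a)"
  define g where "g = (\<lambda>\<xi>. if \<xi> = 0 then 0 else \<A> \<xi> * G \<xi>)"
  have 0: "0 \<notin> ?S" by (rule zero_notin_coset2_half_freq[OF e])
  have "wave_sum G"
    unfolding G_def Psi_eq_wave_sum fourier_sum_wave[abs_def] fourier_wave
    by (rule wave_sumI[of "\<Pi>\<^sub>E \<nu>\<in>UNIV. {..<2 ^ s \<nu>}"]) (auto intro!: finite_PiE simp: fun_eq_iff mult.assoc[symmetric])
  have "wave_sum g"
  proof (rule wave_sum_of_locally_constant)
    fix \<eta> assume "\<eta> \<in> ?S"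
    then have \<eta>: "\<eta> \<noteq> 0" using 0 by auto
    have op: "open (- {0 :: Q2^'a})" by (rule open_Compl) simp
    have "\<forall>\<^sub>F y in at \<eta>. \<A> y = \<A> \<eta>"
    proof -
      have "at \<eta> within - {0} = at \<eta>" using \<eta> by (intro at_within_open op) simp
      moreover have "\<forall>\<^sub>F y in at \<eta> within - {0}. \<A> y = \<A> \<eta>"
        using loc \<eta> unfolding locally_constant_on_def by simp
      ultimately show ?thesis by simp
    qed
    \<comment> \<open>The centre, missing from the punctured filter, satisfies the equation
      trivially.\<close>
    then have A: "\<forall>\<^sub>F y in nhds \<eta>. \<A> y = \<A> \<eta>"
      unfolding eventually_at_filter by (rule eventually_mono) auto
    have nz: "\<forall>\<^sub>F y in nhds \<eta>. y \<in> - {0}" using \<eta> by (intro eventually_nhds_in_open op) simp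
    from A nz wave_sum_locally_constant[OF \<open>wave_sum G\<close>, of \<eta>]
    show "\<forall>\<^sub>F y in nhds \<eta>. g y = g \<eta>" by eventually_elim (use \<eta> in \<open>simp add: g_def\<close>)
  qed (simp add: g_def G_def fourier_Psi)
  then have "g = fourier (inv_fourier g)" by (rule wave_sum_inversion(2)[symmetric])
  also have "inv_fourier g = (\<lambda>x. c * Psi s \<alpha> e j a x)"
    using eigen unfolding pseudo_diff_def g_def G_def .
  finally have "g \<xi> = c * G \<xi>" by (simp add: G_def fourier_scale)
  moreover have "\<xi> \<noteq> 0" using \<xi> 0 by auto
  ultimately show ?thesis using fourier_Psi_nonzero[OF adm \<xi>] by (simp add: g_def G_def)
qed

theorem theorem6p2:
  fixes \<A> :: "Q2^'n \<Rightarrow> complex"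
    and s :: "'n \<Rightarrow> nat"
    and \<alpha> :: "'n \<Rightarrow> nat \<Rightarrow> nat \<Rightarrow> complex"
    and e :: "'n set"
    and j :: int
    and a :: "Q2^'n"
  assumes "locally_constant_on (- {0}) \<A>"
    and "\<And>\<nu>. admissible (s \<nu>) (\<alpha> \<nu>)"
    and "e \<noteq> {}"
    and "\<And>\<nu>. a $ \<nu> \<in> I2"
  shows "(eigenfunction (pseudo_diff \<A>) (Psi s \<alpha> e j a) \<longleftrightarrow>
           (\<forall>\<eta>\<in>Z2n. \<A> ((2 powi j) *s (- (inverse 2 *s k_vec e) + \<eta>)) =
                     \<A> (- ((2 powi (j - 1)) *s k_vec e)))) \<and>
         (eigenfunction (pseudo_diff \<A>) (Psi s \<alpha> e j a) \<longrightarrow>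
           pseudo_diff \<A> (Psi s \<alpha> e j a) =
             (\<lambda>x. \<A> (- ((2 powi (j - 1)) *s k_vec e)) * Psi s \<alpha> e j a x))"
proof -
  let ?S = "coset2 j (- half_freq j e)" and ?\<Psi> = "Psi s \<alpha> e j a"
  \<comment> \<open>Identifies the points tested by the criterion with the support of the
    transform.\<close>
  have S: "?S = (\<lambda>\<eta>. (2 powi j) *s (- (inverse 2 *s k_vec e) + \<eta>)) ` Z2n"
  proof (intro set_eqI iffI)
    fix \<xi> assume "\<xi> \<in> ?S"
    then have "(2 powi (- j)) *s (\<xi> + half_freq j e) \<in> Z2n"
      unfolding Z2n_eq_lattice2 lattice2_scale by (simp add: coset2_def)
    moreover have "\<xi> = (2 powi j) *s (- (inverse 2 *s k_vec e) + (2 powi (- j)) *s (\<xi> + half_freq j e))"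
      by (simp add: vec_eq_iff half_freq_scale power_int_minus algebra_simps)
    ultimately show "\<xi> \<in> (\<lambda>\<eta>. (2 powi j) *s (- (inverse 2 *s k_vec e) + \<eta>)) ` Z2n" by blast
  next
    fix \<xi> assume "\<xi> \<in> (\<lambda>\<eta>. (2 powi j) *s (- (inverse 2 *s k_vec e) + \<eta>)) ` Z2n"
    then obtain \<eta> where \<eta>: "\<eta> \<in> Z2n" "\<xi> = (2 powi j) *s (- (inverse 2 *s k_vec e) + \<eta>)" by blast
    have "\<xi> - (- half_freq j e) = (2 powi j) *s \<eta>"
      unfolding \<eta>(2) half_freq_scale by (simp add: vec_eq_iff algebra_simps)
    then show "\<xi> \<in> ?S" using \<eta>(1) by (simp add: coset2_def Z2n_eq_lattice2 lattice2_scale)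
  qed
  have center: "- half_freq j e \<in> ?S" by simp
  have const_iff: "(\<forall>\<eta>\<in>Z2n. \<A> ((2 powi j) *s (- (inverse 2 *s k_vec e) + \<eta>)) = \<A> (- half_freq j e)) \<longleftrightarrow>
      (\<forall>\<xi>\<in>?S. \<A> \<xi> = \<A> (- half_freq j e))"
    unfolding S by simp
  have eigen: "\<forall>\<xi>\<in>?S. \<A> \<xi> = \<A> (- half_freq j e)" if ef: "eigenfunction (pseudo_diff \<A>) ?\<Psi>"
  proof -
    obtain c where "pseudo_diff \<A> ?\<Psi> = (\<lambda>x. c * ?\<Psi> x)"
      using ef unfolding eigenfunction_def by blast
    from pseudo_diff_Psi_eigenvalue[OF assms(1,2,3) this]
    have "\<A> \<xi> = c" if "\<xi> \<in> ?S" for \<xi> using that .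
    \<comment> \<open>Evaluation at the centre of S identifies the unknown eigenvalue c.\<close>
    then show ?thesis using center by simp
  qed
  have converse: "pseudo_diff \<A> ?\<Psi> = (\<lambda>x. \<A> (- half_freq j e) * ?\<Psi> x)"
    if "\<forall>\<xi>\<in>?S. \<A> \<xi> = \<A> (- half_freq j e)"
    by (rule pseudo_diff_Psi[OF bspec[OF that] assms(3)])
  \<comment> \<open>An eigenfunction must be nonzero, which is read off from one value of its
    transform.\<close>
  have "fourier ?\<Psi> (- half_freq j e) \<noteq> 0"
    by (rule fourier_Psi_nonzero[OF assms(2) center])
  then have "?\<Psi> \<noteq> (\<lambda>x. 0)" by (auto simp: fourier_def)
  then have "eigenfunction (pseudo_diff \<A>) ?\<Psi>" if "\<forall>\<xi>\<in>?S. \<A> \<xi> = \<A> (- half_freq j e)"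
    unfolding eigenfunction_def using Psi_in_lizorkin[OF assms(3)] converse[OF that] by blast
  then show ?thesis
    unfolding half_freq_def[symmetric] const_iff using eigen converse by blast
qed

end
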